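(* Let $\mathbb{K}$ be a field and let $\mathcal{P}$ be a quadratic operad over $\mathbb{K}$ with one generating operation, given by its $\Sigma_2$-module of generators $E$ and its module of relations $R$, where $R$ (of rank $k$) is presented by pairs $(v_p,w_p)\in\mathbb{K}[\Sigma_3]^2$, $1\le p\le k$. Let $\tilde{\mathcal{P}}$ be the associated quadratic operad, with generators $\tilde E$ and relations $\tilde R$ (all as defined in the context). Let $(\mathcal{A},\mu_{\mathcal{A}})$ be a $\mathcal{P}$-algebra and $(\mathcal{B},\mu_{\mathcal{B}})$ a $\tilde{\mathcal{P}}$-algebra. Then the vector space $\mathcal{A}\otimes_{\mathbb{K}}\mathcal{B}$ with the product $\mu_{\mathcal{A}\otimes\mathcal{B}}=\mu_{\mathcal{A}}\otimes\mu_{\mathcal{B}}$, i.e. $$\mu_{\mathcal{A}\otimes\mathcal{B}}(a_1\otimes b_1,\,a_2\otimes b_2)=\mu_{\mathcal{A}}(a_1,a_2)\otimes\mu_{\mathcal{B}}(b_1,b_2),$$ is a $\mathcal{P}$-algebra.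
   Context: Free operad and action. A quadratic operad with one generating operation is $\mathcal{P}=\Gamma(E)/(R)$, where $\Gamma(E)$ is the free operad on a $\Sigma_2$-module $E$ placed in arity 2 and generated by one element, and $R\subset\Gamma(E)(3)$ is a $\Sigma_3$-invariant subspace. The possibilities for $E$ are: $E=\mathbb{K}[\Sigma_2]=1\!\!1\oplus Sgn_2$ (an operation with no symmetry), $E=1\!\!1$ (trivial representation: a commutative operation), $E=Sgn_2$ (signum representation: an anticommutative operation). For $E=\mathbb{K}[\Sigma_2]$, $\Gamma(E)(3)$ is the 12-dimensional space with basis $x_i\cdot(x_j\cdot x_k)$, $(x_i\cdot x_j)\cdot x_k$, $\{i,j,k\}=\{1,2,3\}$; for $E=1\!\!1$ or $Sgn_2$ it is the quotient of this space by the relations expressing commutativity, respectively anticommutativity, of the product. $\Sigma_3$ acts on $\Gamma(E)(3)$ by $\sigma(x_i\cdot(x_j\cdot x_k))=x_{\sigma^{-1}(i)}\cdot(x_{\sigma^{-1}(j)}\cdot x_{\sigma^{-1}(k)})$ and $\sigma((x_i\cdot x_j)\cdot x_k)=(x_{\sigma^{-1}(i)}\cdot x_{\sigma^{-1}(j)})\cdot x_{\sigma^{-1}(k)}$. Rank. A $\Sigma_3$-invariant subspace $F$ of $\Gamma(E)(3)$ is of rank $k$ if it is the span of the union of the $\Sigma_3$-orbits of $k$ linearly independent vectors, and it is not the span of the union of the orbits of any $p<k$ vectors of $F$. Presentation of $R$. Write $\Sigma_3=\{\sigma_1,\dots,\sigma_6\}$. If $R$ is of rank $k$, it is presented as the $\Sigma_3$-invariant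 subspace generated by the $k$ vectors $$\sum_{i=1}^6 a_i^p\,\sigma_i\big((x_1\cdot x_2)\cdot x_3\big)-\sum_{i=1}^6 b_i^p\,\sigma_i\big(x_1\cdot(x_2\cdot x_3)\big),\qquad 1\le p\le k,$$ with $v_p=\sum_i a_i^p\sigma_i$ and $w_p=\sum_i b_i^p\sigma_i$ in $\mathbb{K}[\Sigma_3]$. Such a presentation is fixed. Algebras. A $\mathcal{P}$-algebra is a $\mathbb{K}$-vector space $\mathcal{A}$ with a bilinear product $\mu$ (commutative if $E=1\!\!1$, anticommutative if $E=Sgn_2$, arbitrary if $E=\mathbb{K}[\Sigma_2]$) such that, for all $p$ and all $x_1,x_2,x_3\in\mathcal{A}$, $$\sum_i a_i^p\,\mu\big(\mu(x_{\sigma_i^{-1}(1)},x_{\sigma_i^{-1}(2)}),x_{\sigma_i^{-1}(3)}\big)-\sum_i b_i^p\,\mu\big(x_{\sigma_i^{-1}(1)},\mu(x_{\sigma_i^{-1}(2)},x_{\sigma_i^{-1}(3)})\big)=0.$$ The operad $\tilde{\mathcal{P}}$. Put $\tilde E=E$ if $E=1\!\!1\oplus Sgn_2$, and $\tilde E=1\!\!1$ if $E=1\!\!1$ or $E=Sgn_2$. Let $\tilde R\subset\Gamma(\tilde E)(3)$ be the $\Sigma_3$-invariant subspace generated by the following vectors (their classes modulo the commutativity relations when $\tilde E=1\!\!1$), for all $1\le p\le k$ and $1\le i,j\le 6$: $$a_i^p a_j^p\,\big(\sigma_i((x_1\cdot x_2)\cdot x_3)-\sigma_j((x_1\cdot x_2)\cdot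 x_3)\big),$$ $$b_i^p b_j^p\,\big(\sigma_i(x_1\cdot(x_2\cdot x_3))-\sigma_j(x_1\cdot(x_2\cdot x_3))\big),$$ $$a_i^p b_j^p\,\big(\sigma_i((x_1\cdot x_2)\cdot x_3)-\sigma_j(x_1\cdot(x_2\cdot x_3))\big).$$ Then $\tilde{\mathcal{P}}=\Gamma(\tilde E)/(\tilde R)$. A $\tilde{\mathcal{P}}$-algebra is a vector space with a bilinear product (commutative if $\tilde E=1\!\!1$) satisfying all the identities in $\tilde R$. *)

theory Defs
  imports "HOL.Hull" "HOL-Combinatorics.Permutations" "HOL-Algebra.Module" "HOL-Algebra.AbelCoset"
begin

text \<open>
  Modules are represented by the record type of \<^theory>\<open>HOL-Algebra.Module\<close>. The
  ring multiplication and unit that this record type inherits play no role and are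
  left undefined in the modules constructed here.
\<close>

definition free_module :: "('k, 'm) ring_scheme \<Rightarrow> 'x set \<Rightarrow> ('k, 'x \<Rightarrow> 'k) module" where
  "free_module K X =
    \<lparr>carrier = {f. (\<forall>x\<in>X. f x \<in> carrier K) \<and> (\<forall>x. x \<notin> X \<longrightarrow> f x = \<zero>\<^bsub>K\<^esub>) \<and>
                   finite {x. f x \<noteq> \<zero>\<^bsub>K\<^esub>}},
     mult = undefined, one = undefined,
     zero = (\<lambda>_. \<zero>\<^bsub>K\<^esub>), add = (\<lambda>f g x. f x \<oplus>\<^bsub>K\<^esub> g x),
     smult = (\<lambda>c f x. c \<otimes>\<^bsub>K\<^esub> f x)\<rparr>"

definition basis_vec :: "('k, 'm) ring_scheme \<Rightarrow> 'x \<Rightarrow> 'x \<Rightarrow> 'k" where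
  "basis_vec K x = (\<lambda>y. if y = x then \<one>\<^bsub>K\<^esub> else \<zero>\<^bsub>K\<^esub>)"

text \<open>The linear map from a free module to \<open>V\<close> that sends the basis element \<open>x\<close> to \<open>h x\<close>.\<close>

definition lin_ext ::
  "('k, 'm) ring_scheme \<Rightarrow> ('k, 'v, 'n) module_scheme \<Rightarrow> ('x \<Rightarrow> 'v) \<Rightarrow> ('x \<Rightarrow> 'k) \<Rightarrow> 'v" where
  "lin_ext K V h f = (\<Oplus>\<^bsub>V\<^esub>x\<in>{x. f x \<noteq> \<zero>\<^bsub>K\<^esub>}. f x \<odot>\<^bsub>V\<^esub> h x)"

definition spanned :: "('k, 'm) ring_scheme \<Rightarrow> ('k, 'v, 'n) module_scheme \<Rightarrow> 'v set \<Rightarrow> 'v set" where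
  "spanned K V S = (\<lambda>H. submodule H K V) hull S"

definition lin_indep :: "('k, 'm) ring_scheme \<Rightarrow> ('k, 'v, 'n) module_scheme \<Rightarrow> 'v set \<Rightarrow> bool" where
  "lin_indep K V S \<longleftrightarrow>
    (\<forall>T c. finite T \<and> T \<subseteq> S \<and> c \<in> T \<rightarrow> carrier K \<and> (\<Oplus>\<^bsub>V\<^esub>v\<in>T. c v \<odot>\<^bsub>V\<^esub> v) = \<zero>\<^bsub>V\<^esub>
       \<longrightarrow> (\<forall>v\<in>T. c v = \<zero>\<^bsub>K\<^esub>))"

definition quot_module :: "('k, 'v, 'n) module_scheme \<Rightarrow> 'v set \<Rightarrow> ('k, 'v set) module" where
  "quot_module V W =
    \<lparr>carrier = a_rcosets\<^bsub>V\<^esub> W,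
     mult = undefined, one = undefined,
     zero = W, add = (\<lambda>X Y. X <+>\<^bsub>V\<^esub> Y),
     smult = (\<lambda>c X. \<Union>x\<in>X. W +>\<^bsub>V\<^esub> (c \<odot>\<^bsub>V\<^esub> x))\<rparr>"

definition tensor_relations ::
  "('k, 'm) ring_scheme \<Rightarrow> ('k, 'a, 'p) module_scheme \<Rightarrow> ('k, 'b, 'q) module_scheme
    \<Rightarrow> ('a \<times> 'b \<Rightarrow> 'k) set" where
  "tensor_relations K A B =
    (let F = free_module K (carrier A \<times> carrier B); e = basis_vec K in
     spanned K F
      ({e (x \<oplus>\<^bsub>A\<^esub> x', y) \<ominus>\<^bsub>F\<^esub> (e (x, y) \<oplus>\<^bsub>F\<^esub> e (x', y)) | x x' y.
          x \<in> carrier A \<and> x' \<in> carrier A \<and> y \<in> carrier B} \<union>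
       {e (x, y \<oplus>\<^bsub>B\<^esub> y') \<ominus>\<^bsub>F\<^esub> (e (x, y) \<oplus>\<^bsub>F\<^esub> e (x, y')) | x y y'.
          x \<in> carrier A \<and> y \<in> carrier B \<and> y' \<in> carrier B} \<union>
       {e (c \<odot>\<^bsub>A\<^esub> x, y) \<ominus>\<^bsub>F\<^esub> (c \<odot>\<^bsub>F\<^esub> e (x, y)) | c x y.
          c \<in> carrier K \<and> x \<in> carrier A \<and> y \<in> carrier B} \<union>
       {e (x, c \<odot>\<^bsub>B\<^esub> y) \<ominus>\<^bsub>F\<^esub> (c \<odot>\<^bsub>F\<^esub> e (x, y)) | c x y.
          c \<in> carrier K \<and> x \<in> carrier A \<and> y \<in> carrier B}))"

definition tensor_module ::
  "('k, 'm) ring_scheme \<Rightarrow> ('k, 'a, 'p) module_scheme \<Rightarrow> ('k, 'b, 'q) module_scheme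
    \<Rightarrow> ('k, ('a \<times> 'b \<Rightarrow> 'k) set) module" where
  "tensor_module K A B =
    quot_module (free_module K (carrier A \<times> carrier B)) (tensor_relations K A B)"

definition pure_tensor ::
  "('k, 'm) ring_scheme \<Rightarrow> ('k, 'a, 'p) module_scheme \<Rightarrow> ('k, 'b, 'q) module_scheme
    \<Rightarrow> 'a \<Rightarrow> 'b \<Rightarrow> ('a \<times> 'b \<Rightarrow> 'k) set" where
  "pure_tensor K A B x y =
    tensor_relations K A B +>\<^bsub>free_module K (carrier A \<times> carrier B)\<^esub> basis_vec K (x, y)"

text \<open>
  The product of two cosets is the coset of the product of any representatives, where
  products in the free module on pairs are formed bilinearly from
  \<open>(x, y) \<cdot> (x', y') = (\<mu> x x', \<nu> y y')\<close>.
\<close>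

definition tensor_product_map ::
  "('k, 'm) ring_scheme \<Rightarrow> ('k, 'a, 'p) module_scheme \<Rightarrow> ('k, 'b, 'q) module_scheme
    \<Rightarrow> ('a \<Rightarrow> 'a \<Rightarrow> 'a) \<Rightarrow> ('b \<Rightarrow> 'b \<Rightarrow> 'b)
    \<Rightarrow> ('a \<times> 'b \<Rightarrow> 'k) set \<Rightarrow> ('a \<times> 'b \<Rightarrow> 'k) set \<Rightarrow> ('a \<times> 'b \<Rightarrow> 'k) set" where
  "tensor_product_map K A B \<mu> \<nu> S T =
    (let F = free_module K (carrier A \<times> carrier B) in
     \<Union>s\<in>S. \<Union>t\<in>T. tensor_relations K A B +>\<^bsub>F\<^esub>
       lin_ext K F (\<lambda>(x, y). lin_ext K F (\<lambda>(x', y'). basis_vec K (\<mu> x x', \<nu> y y')) t) s)"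


text \<open>
  The three possible \<open>\<Sigma>\<^sub>2\<close>-modules of generators: the regular representation, the
  trivial representation and the signum representation.
\<close>

datatype generators = Regular | Trivial | Signum

text \<open>\<open>LeftMono i j k\<close> is \<open>(x\<^sub>i \<cdot> x\<^sub>j) \<cdot> x\<^sub>k\<close> and \<open>RightMono i j k\<close> is \<open>x\<^sub>i \<cdot> (x\<^sub>j \<cdot> x\<^sub>k)\<close>.\<close>

datatype monomial = LeftMono nat nat nat | RightMono nat nat nat

definition monomials :: "monomial set" where
  "monomials = {LeftMono i j k | i j k. {i, j, k} = {1, 2, 3}} \<union>
               {RightMono i j k | i j k. {i, j, k} = {1, 2, 3}}"

definition Sigma3 :: "(nat \<Rightarrow> nat) set" where
  "Sigma3 = {\<sigma>. \<sigma> permutes {1, 2, 3}}"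

fun act_mono :: "(nat \<Rightarrow> nat) \<Rightarrow> monomial \<Rightarrow> monomial" where
  "act_mono \<sigma> (LeftMono i j k) =
     LeftMono (inv_into UNIV \<sigma> i) (inv_into UNIV \<sigma> j) (inv_into UNIV \<sigma> k)"
| "act_mono \<sigma> (RightMono i j k) =
     RightMono (inv_into UNIV \<sigma> i) (inv_into UNIV \<sigma> j) (inv_into UNIV \<sigma> k)"

text \<open>
  The relations \<open>u \<cdot> v = \<epsilon> (v \<cdot> u)\<close> among monomials, with \<open>\<epsilon> = 1\<close> for the trivial and
  \<open>\<epsilon> = -1\<close> for the signum representation. They may be applied to either one of the two
  products in a monomial.
\<close>

definition symmetry_relations ::
  "('k, 'm) ring_scheme \<Rightarrow> generators \<Rightarrow> (monomial \<Rightarrow> 'k) set" where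
  "symmetry_relations K E =
    (let F = free_module K monomials; e = basis_vec K;
         rels = (\<lambda>\<epsilon>.
           {e (LeftMono i j k) \<ominus>\<^bsub>F\<^esub> (\<epsilon> \<odot>\<^bsub>F\<^esub> e (LeftMono j i k)) | i j k. {i, j, k} = {1, 2, 3}} \<union>
           {e (RightMono i j k) \<ominus>\<^bsub>F\<^esub> (\<epsilon> \<odot>\<^bsub>F\<^esub> e (RightMono i k j)) | i j k. {i, j, k} = {1, 2, 3}} \<union>
           {e (RightMono i j k) \<ominus>\<^bsub>F\<^esub> (\<epsilon> \<odot>\<^bsub>F\<^esub> e (LeftMono j k i)) | i j k. {i, j, k} = {1, 2, 3}})
     in spanned K F
          (case E of Regular \<Rightarrow> {} | Trivial \<Rightarrow> rels \<one>\<^bsub>K\<^esub> | Signum \<Rightarrow> rels (\<ominus>\<^bsub>K\<^esub> \<one>\<^bsub>K\<^esub>)))"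

text \<open>
  For the regular representation one divides by the zero submodule, so the elements of
  \<open>\<Gamma>(E)(3)\<close> are then singletons.
\<close>

definition Gamma3 ::
  "('k, 'm) ring_scheme \<Rightarrow> generators \<Rightarrow> ('k, (monomial \<Rightarrow> 'k) set) module" where
  "Gamma3 K E = quot_module (free_module K monomials) (symmetry_relations K E)"

definition cls ::
  "('k, 'm) ring_scheme \<Rightarrow> generators \<Rightarrow> (monomial \<Rightarrow> 'k) \<Rightarrow> (monomial \<Rightarrow> 'k) set" where
  "cls K E f = symmetry_relations K E +>\<^bsub>free_module K monomials\<^esub> f"

definition act_free ::
  "('k, 'm) ring_scheme \<Rightarrow> (nat \<Rightarrow> nat) \<Rightarrow> (monomial \<Rightarrow> 'k) \<Rightarrow> monomial \<Rightarrow> 'k" where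
  "act_free K \<sigma> = lin_ext K (free_module K monomials) (\<lambda>m. basis_vec K (act_mono \<sigma> m))"

text \<open>
  The symmetry relations are stable under \<open>\<Sigma>\<^sub>3\<close>, so the induced action on
  \<open>\<Gamma>(E)(3)\<close> is the direct image of cosets.
\<close>

definition orbit_union ::
  "('k, 'm) ring_scheme \<Rightarrow> (monomial \<Rightarrow> 'k) set set \<Rightarrow> (monomial \<Rightarrow> 'k) set set" where
  "orbit_union K S = (\<Union>\<sigma>\<in>Sigma3. (\<lambda>X. act_free K \<sigma> ` X) ` S)"

definition orbit_span ::
  "('k, 'm) ring_scheme \<Rightarrow> generators \<Rightarrow> (monomial \<Rightarrow> 'k) set set \<Rightarrow> (monomial \<Rightarrow> 'k) set set" where
  "orbit_span K E S = spanned K (Gamma3 K E) (orbit_union K S)"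

definition invariant_subspace ::
  "('k, 'm) ring_scheme \<Rightarrow> generators \<Rightarrow> (monomial \<Rightarrow> 'k) set set \<Rightarrow> bool" where
  "invariant_subspace K E R \<longleftrightarrow> submodule R K (Gamma3 K E) \<and> orbit_union K R \<subseteq> R"

definition has_rank ::
  "('k, 'm) ring_scheme \<Rightarrow> generators \<Rightarrow> (monomial \<Rightarrow> 'k) set set \<Rightarrow> nat \<Rightarrow> bool" where
  "has_rank K E R k \<longleftrightarrow>
    (\<exists>S \<subseteq> carrier (Gamma3 K E). finite S \<and> card S = k \<and> lin_indep K (Gamma3 K E) S \<and>
       R = orbit_span K E S) \<and>
    \<not> (\<exists>S \<subseteq> R. finite S \<and> card S < k \<and> R = orbit_span K E S)"


definition left_mono :: "(nat \<Rightarrow> nat) \<Rightarrow> monomial" where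
  "left_mono \<sigma> = act_mono \<sigma> (LeftMono 1 2 3)"

definition right_mono :: "(nat \<Rightarrow> nat) \<Rightarrow> monomial" where
  "right_mono \<sigma> = act_mono \<sigma> (RightMono 1 2 3)"

text \<open>
  The vectors \<open>v\<^sub>p\<close> and \<open>w\<^sub>p\<close> of the group algebra are given by their coefficient
  functions \<open>a p\<close> and \<open>b p\<close> on \<open>\<Sigma>\<^sub>3\<close>.
\<close>

definition relator ::
  "('k, 'm) ring_scheme \<Rightarrow> ((nat \<Rightarrow> nat) \<Rightarrow> 'k) \<Rightarrow> ((nat \<Rightarrow> nat) \<Rightarrow> 'k) \<Rightarrow> monomial \<Rightarrow> 'k" where
  "relator K v w =
    (let F = free_module K monomials in
     (\<Oplus>\<^bsub>F\<^esub>\<sigma>\<in>Sigma3. v \<sigma> \<odot>\<^bsub>F\<^esub> basis_vec K (left_mono \<sigma>)) \<ominus>\<^bsub>F\<^esub>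
     (\<Oplus>\<^bsub>F\<^esub>\<sigma>\<in>Sigma3. w \<sigma> \<odot>\<^bsub>F\<^esub> basis_vec K (right_mono \<sigma>)))"

definition presented_by ::
  "('k, 'm) ring_scheme \<Rightarrow> generators \<Rightarrow> (monomial \<Rightarrow> 'k) set set \<Rightarrow> nat
    \<Rightarrow> (nat \<Rightarrow> (nat \<Rightarrow> nat) \<Rightarrow> 'k) \<Rightarrow> (nat \<Rightarrow> (nat \<Rightarrow> nat) \<Rightarrow> 'k) \<Rightarrow> bool" where
  "presented_by K E R k a b \<longleftrightarrow>
    (\<forall>p\<in>{1..k}. \<forall>\<sigma>\<in>Sigma3. a p \<sigma> \<in> carrier K \<and> b p \<sigma> \<in> carrier K) \<and>
    R = orbit_span K E {cls K E (relator K (a p) (b p)) | p. p \<in> {1..k}}"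

fun tilde_generators :: "generators \<Rightarrow> generators" where
  "tilde_generators Regular = Regular"
| "tilde_generators Trivial = Trivial"
| "tilde_generators Signum = Trivial"

definition tilde_relations ::
  "('k, 'm) ring_scheme \<Rightarrow> generators \<Rightarrow> nat
    \<Rightarrow> (nat \<Rightarrow> (nat \<Rightarrow> nat) \<Rightarrow> 'k) \<Rightarrow> (nat \<Rightarrow> (nat \<Rightarrow> nat) \<Rightarrow> 'k)
    \<Rightarrow> (monomial \<Rightarrow> 'k) set set" where
  "tilde_relations K E k a b =
    (let F = free_module K monomials; e = basis_vec K; E' = tilde_generators E in
     orbit_span K E'
      ({cls K E' ((a p \<sigma> \<otimes>\<^bsub>K\<^esub> a p \<tau>) \<odot>\<^bsub>F\<^esub> (e (left_mono \<sigma>) \<ominus>\<^bsub>F\<^esub> e (left_mono \<tau>))) | p \<sigma> \<tau>.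
          p \<in> {1..k} \<and> \<sigma> \<in> Sigma3 \<and> \<tau> \<in> Sigma3} \<union>
       {cls K E' ((b p \<sigma> \<otimes>\<^bsub>K\<^esub> b p \<tau>) \<odot>\<^bsub>F\<^esub> (e (right_mono \<sigma>) \<ominus>\<^bsub>F\<^esub> e (right_mono \<tau>))) | p \<sigma> \<tau>.
          p \<in> {1..k} \<and> \<sigma> \<in> Sigma3 \<and> \<tau> \<in> Sigma3} \<union>
       {cls K E' ((a p \<sigma> \<otimes>\<^bsub>K\<^esub> b p \<tau>) \<odot>\<^bsub>F\<^esub> (e (left_mono \<sigma>) \<ominus>\<^bsub>F\<^esub> e (right_mono \<tau>))) | p \<sigma> \<tau>.
          p \<in> {1..k} \<and> \<sigma> \<in> Sigma3 \<and> \<tau> \<in> Sigma3}))"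


definition bilinear_product ::
  "('k, 'm) ring_scheme \<Rightarrow> ('k, 'a, 'p) module_scheme \<Rightarrow> ('a \<Rightarrow> 'a \<Rightarrow> 'a) \<Rightarrow> bool" where
  "bilinear_product K A \<mu> \<longleftrightarrow>
    (\<forall>x\<in>carrier A. \<forall>y\<in>carrier A. \<mu> x y \<in> carrier A) \<and>
    (\<forall>x\<in>carrier A. \<forall>x'\<in>carrier A. \<forall>y\<in>carrier A. \<mu> (x \<oplus>\<^bsub>A\<^esub> x') y = \<mu> x y \<oplus>\<^bsub>A\<^esub> \<mu> x' y) \<and>
    (\<forall>x\<in>carrier A. \<forall>y\<in>carrier A. \<forall>y'\<in>carrier A. \<mu> x (y \<oplus>\<^bsub>A\<^esub> y') = \<mu> x y \<oplus>\<^bsub>A\<^esub> \<mu> x y') \<and>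
    (\<forall>c\<in>carrier K. \<forall>x\<in>carrier A. \<forall>y\<in>carrier A. \<mu> (c \<odot>\<^bsub>A\<^esub> x) y = c \<odot>\<^bsub>A\<^esub> \<mu> x y) \<and>
    (\<forall>c\<in>carrier K. \<forall>x\<in>carrier A. \<forall>y\<in>carrier A. \<mu> x (c \<odot>\<^bsub>A\<^esub> y) = c \<odot>\<^bsub>A\<^esub> \<mu> x y)"

fun has_symmetry ::
  "generators \<Rightarrow> ('k, 'a, 'p) module_scheme \<Rightarrow> ('a \<Rightarrow> 'a \<Rightarrow> 'a) \<Rightarrow> bool" where
  "has_symmetry Regular A \<mu> \<longleftrightarrow> True"
| "has_symmetry Trivial A \<mu> \<longleftrightarrow> (\<forall>x\<in>carrier A. \<forall>y\<in>carrier A. \<mu> x y = \<mu> y x)"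
| "has_symmetry Signum A \<mu> \<longleftrightarrow> (\<forall>x\<in>carrier A. \<forall>y\<in>carrier A. \<mu> x y = \<ominus>\<^bsub>A\<^esub> \<mu> y x)"

definition operad_algebra ::
  "('k, 'm) ring_scheme \<Rightarrow> generators \<Rightarrow> nat
    \<Rightarrow> (nat \<Rightarrow> (nat \<Rightarrow> nat) \<Rightarrow> 'k) \<Rightarrow> (nat \<Rightarrow> (nat \<Rightarrow> nat) \<Rightarrow> 'k)
    \<Rightarrow> ('k, 'a, 'p) module_scheme \<Rightarrow> ('a \<Rightarrow> 'a \<Rightarrow> 'a) \<Rightarrow> bool" where
  "operad_algebra K E k a b A \<mu> \<longleftrightarrow>
    module K A \<and> bilinear_product K A \<mu> \<and> has_symmetry E A \<mu> \<and>
    (\<forall>p\<in>{1..k}. \<forall>x\<in>{1, 2, 3} \<rightarrow> carrier A.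
      (\<Oplus>\<^bsub>A\<^esub>\<sigma>\<in>Sigma3. a p \<sigma> \<odot>\<^bsub>A\<^esub>
         \<mu> (\<mu> (x (inv_into UNIV \<sigma> 1)) (x (inv_into UNIV \<sigma> 2))) (x (inv_into UNIV \<sigma> 3))) \<ominus>\<^bsub>A\<^esub>
      (\<Oplus>\<^bsub>A\<^esub>\<sigma>\<in>Sigma3. b p \<sigma> \<odot>\<^bsub>A\<^esub>
         \<mu> (x (inv_into UNIV \<sigma> 1)) (\<mu> (x (inv_into UNIV \<sigma> 2)) (x (inv_into UNIV \<sigma> 3))))
      = \<zero>\<^bsub>A\<^esub>)"

fun eval_mono :: "('a \<Rightarrow> 'a \<Rightarrow> 'a) \<Rightarrow> (nat \<Rightarrow> 'a) \<Rightarrow> monomial \<Rightarrow> 'a" where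
  "eval_mono \<mu> x (LeftMono i j k) = \<mu> (\<mu> (x i) (x j)) (x k)"
| "eval_mono \<mu> x (RightMono i j k) = \<mu> (x i) (\<mu> (x j) (x k))"

text \<open>
  An identity in \<open>\<Gamma>(E')(3)\<close> is a coset; it is imposed through all its representatives,
  which agree on any product of the required symmetry.
\<close>

definition tilde_operad_algebra ::
  "('k, 'm) ring_scheme \<Rightarrow> generators \<Rightarrow> nat
    \<Rightarrow> (nat \<Rightarrow> (nat \<Rightarrow> nat) \<Rightarrow> 'k) \<Rightarrow> (nat \<Rightarrow> (nat \<Rightarrow> nat) \<Rightarrow> 'k)
    \<Rightarrow> ('k, 'b, 'q) module_scheme \<Rightarrow> ('b \<Rightarrow> 'b \<Rightarrow> 'b) \<Rightarrow> bool" where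
  "tilde_operad_algebra K E k a b B \<nu> \<longleftrightarrow>
    module K B \<and> bilinear_product K B \<nu> \<and> has_symmetry (tilde_generators E) B \<nu> \<and>
    (\<forall>r\<in>tilde_relations K E k a b. \<forall>f\<in>r. \<forall>y\<in>{1, 2, 3} \<rightarrow> carrier B.
      lin_ext K B (eval_mono \<nu> y) f = \<zero>\<^bsub>B\<^esub>)"

end

theory Submission
  imports Defs
begin

text \<open>
  An identity of the operad is trilinear, so on a tensor product it only has to be checked on
  pure tensors, where a monomial evaluates to the pure tensor of its values in \<open>A\<close> and in \<open>B\<close>.
  Over a field the relations of the associated operad say that all monomials with a nonzero
  coefficient in the identity have one common value \<open>z\<close> in \<open>B\<close>. The identity therefore
  evaluates to (its value in \<open>A\<close>) \<open>\<otimes> z = 0 \<otimes> z = 0\<close>. The product of cosets is independent of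
  representatives because multiplying the tensor relations by a basis pair induces a bilinear map
  of the other two arguments.
\<close>

section \<open>Linear maps and submodules\<close>

text \<open>Statements are extended from generators by one device: the elements that satisfy a
  linear condition form a submodule, so it suffices that this submodule contains a basis or the pure
  tensors.

  An identity is treated as the value of a linear map (evaluation of monomials) at a fixed formal
  vector, the relator. The value \<open>z\<close> depends on the chosen arguments in
  \<open>B\<close>, and only monomials with nonzero coefficient are known to take it. The other
  monomials contribute nothing, so their factor in \<open>B\<close> may be replaced by
  \<open>z\<close> as well. After this replacement evaluation factors through evaluation in
  \<open>A\<close> followed by the linear map \<open>\<lambda>x. pure x z\<close>.

  The coefficient products in the associated relations encode occurrence: over a field, such a
  product is nonzero exactly when both monomials occur. Each generator therefore either is trivial
  or, after cancelling a unit, equates two monomials that occur.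

  The associated product is commutative even when the given one is anticommutative, because the sign
  of a swap is already supplied by \<open>A\<close>; a second sign from \<open>B\<close> would
  cancel it.\<close>

definition linear_map ::
  "('k, 'm) ring_scheme \<Rightarrow> ('k, 'v, 'n) module_scheme \<Rightarrow> ('k, 'w, 'o) module_scheme
    \<Rightarrow> ('v \<Rightarrow> 'w) \<Rightarrow> bool" where
  "linear_map K V W h \<longleftrightarrow>
    h \<in> carrier V \<rightarrow> carrier W \<and>
    (\<forall>x\<in>carrier V. \<forall>y\<in>carrier V. h (x \<oplus>\<^bsub>V\<^esub> y) = h x \<oplus>\<^bsub>W\<^esub> h y) \<and>
    (\<forall>c\<in>carrier K. \<forall>x\<in>carrier V. h (c \<odot>\<^bsub>V\<^esub> x) = c \<odot>\<^bsub>W\<^esub> h x)"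

lemma linear_mapI:
  assumes "\<And>x. x \<in> carrier V \<Longrightarrow> h x \<in> carrier W"
    and "\<And>x y. x \<in> carrier V \<Longrightarrow> y \<in> carrier V \<Longrightarrow> h (x \<oplus>\<^bsub>V\<^esub> y) = h x \<oplus>\<^bsub>W\<^esub> h y"
    and "\<And>c x. c \<in> carrier K \<Longrightarrow> x \<in> carrier V \<Longrightarrow> h (c \<odot>\<^bsub>V\<^esub> x) = c \<odot>\<^bsub>W\<^esub> h x"
  shows "linear_map K V W h"
  using assms by (auto simp: linear_map_def)

lemma linear_map_closed: "linear_map K V W h \<Longrightarrow> x \<in> carrier V \<Longrightarrow> h x \<in> carrier W"
  and linear_map_add:
    "linear_map K V W h \<Longrightarrow> x \<in> carrier V \<Longrightarrow> y \<in> carrier V \<Longrightarrow> h (x \<oplus>\<^bsub>V\<^esub> y) = h x \<oplus>\<^bsub>W\<^esub> h y"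
  and linear_map_smult:
    "linear_map K V W h \<Longrightarrow> c \<in> carrier K \<Longrightarrow> x \<in> carrier V \<Longrightarrow> h (c \<odot>\<^bsub>V\<^esub> x) = c \<odot>\<^bsub>W\<^esub> h x"
  by (auto simp: linear_map_def)

lemma linear_map_comp:
  assumes "linear_map K U V g" and "linear_map K V W h"
  shows "linear_map K U W (\<lambda>x. h (g x))"
  using assms by (auto simp: linear_map_def Pi_iff)

lemma linear_map_ident: "linear_map K V V (\<lambda>x. x)"
  by (auto simp: linear_map_def)

context
  fixes K :: "('k, 'm) ring_scheme"
    and V :: "('k, 'v, 'n) module_scheme" and W :: "('k, 'w, 'o) module_scheme"
  assumes V: "module K V" and W: "module K W"
begin

interpretation V: module K V by (rule V)
interpretation W: module K W by (rule W)

lemma linear_map_zero: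
  assumes "linear_map K V W h"
  shows "h \<zero>\<^bsub>V\<^esub> = \<zero>\<^bsub>W\<^esub>"
proof -
  have "h (\<zero>\<^bsub>K\<^esub> \<odot>\<^bsub>V\<^esub> \<zero>\<^bsub>V\<^esub>) = \<zero>\<^bsub>K\<^esub> \<odot>\<^bsub>W\<^esub> h \<zero>\<^bsub>V\<^esub>"
    by (intro linear_map_smult[OF assms]) simp_all
  then show ?thesis using linear_map_closed[OF assms] by simp
qed

lemma linear_map_neg:
  assumes "linear_map K V W h" and "x \<in> carrier V"
  shows "h (\<ominus>\<^bsub>V\<^esub> x) = \<ominus>\<^bsub>W\<^esub> h x"
proof -
  have "h x \<oplus>\<^bsub>W\<^esub> h (\<ominus>\<^bsub>V\<^esub> x) = \<zero>\<^bsub>W\<^esub>"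
    using linear_map_add[OF assms(1), of x "\<ominus>\<^bsub>V\<^esub> x"] linear_map_zero[OF assms(1)] assms(2)
    by (simp add: V.r_neg)
  then show ?thesis
    using linear_map_closed[OF assms(1)] assms(2) W.minus_equality W.add.m_comm
    by (metis V.add.inv_closed)
qed

lemma linear_map_diff:
  assumes "linear_map K V W h" and "x \<in> carrier V" and "y \<in> carrier V"
  shows "h (x \<ominus>\<^bsub>V\<^esub> y) = h x \<ominus>\<^bsub>W\<^esub> h y"
  using assms by (simp add: a_minus_def linear_map_add linear_map_neg)

lemma linear_map_finsum:
  assumes "linear_map K V W h" and "f \<in> I \<rightarrow> carrier V"
  shows "h (\<Oplus>\<^bsub>V\<^esub>i\<in>I. f i) = (\<Oplus>\<^bsub>W\<^esub>i\<in>I. h (f i))"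
  using assms(2)
proof (induction I rule: infinite_finite_induct)
  case (insert i I)
  then show ?case
    by (simp add: linear_map_add[OF assms(1)] linear_map_closed[OF assms(1)] Pi_iff)
qed (simp_all add: linear_map_zero[OF assms(1)])

text \<open>Taking \<open>N\<close> to be the zero submodule gives kernels; that is the form in
  which vanishing statements are later extended from generators. \<open>submodule_equalizer\<close>
  plays the same part for equations between two linear maps.\<close>

lemma submodule_preimage:
  assumes "linear_map K V W h" and "submodule N K W"
  shows "submodule {x \<in> carrier V. h x \<in> N} K V"
  using W.submoduleE[OF assms(2)] submodule.axioms(1)[OF assms(2)]
  by (intro V.submoduleI)
    (auto simp: linear_map_zero[OF assms(1)] linear_map_neg[OF assms(1)] linear_map_add[OF assms(1)]
      linear_map_smult[OF assms(1)] dest: subgroup.one_closed)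

lemma submodule_equalizer:
  assumes g: "linear_map K V W g" and h: "linear_map K V W h"
  shows "submodule {x \<in> carrier V. g x = h x} K V"
  by (intro V.submoduleI)
    (auto simp: linear_map_zero[OF g] linear_map_neg[OF g] linear_map_add[OF g]
      linear_map_smult[OF g] linear_map_zero[OF h] linear_map_neg[OF h] linear_map_add[OF h]
      linear_map_smult[OF h])

end

lemma linear_map_scale:
  assumes "module K V" and "c \<in> carrier K"
  shows "linear_map K V V (\<lambda>x. c \<odot>\<^bsub>V\<^esub> x)"
proof -
  interpret V: module K V by fact
  show ?thesis
    using assms(2)
    by (intro linear_mapI)
      (auto simp: V.smult_r_distr V.R.m_comm simp flip: V.smult_assoc1)
qed

section \<open>The zero submodule and spans\<close>

lemma submodule_zero:
  assumes "module K V"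
  shows "submodule {\<zero>\<^bsub>V\<^esub>} K V"
proof -
  interpret V: module K V by fact
  show ?thesis by (intro V.submoduleI) auto
qed

lemma zero_in_submodule: "submodule H K V \<Longrightarrow> \<zero>\<^bsub>V\<^esub> \<in> H"
  using submodule.axioms(1) subgroup.one_closed by fastforce

lemma zero_in_spanned: "\<zero>\<^bsub>V\<^esub> \<in> spanned K V S"
  unfolding spanned_def hull_def by (auto intro: zero_in_submodule)

lemma submodule_spanned:
  assumes "module K V" and "S \<subseteq> carrier V"
  shows "submodule (spanned K V S) K V"
proof -
  interpret V: module K V by fact
  show ?thesis
    unfolding spanned_def hull_def
  proof (rule V.submoduleI)
    \<comment> \<open>The carrier is itself a member of the family. Without such a member the
      intersection would be over the empty family, hence the whole type.\<close>
    show "\<Inter>{H. submodule H K V \<and> S \<subseteq> H} \<subseteq> carrier V"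
      using V.carrier_is_submodule assms(2) by blast
  qed (auto intro: zero_in_submodule V.submoduleE(3-5))
qed

lemma spanned_least: "submodule H K V \<Longrightarrow> S \<subseteq> H \<Longrightarrow> spanned K V S \<subseteq> H"
  unfolding spanned_def by (rule hull_minimal)

lemma spanned_inc: "x \<in> S \<Longrightarrow> x \<in> spanned K V S"
  unfolding spanned_def by (rule hull_inc)

section \<open>Quotients\<close>

context
  fixes K :: "('k, 'm) ring_scheme" and V :: "('k, 'v, 'n) module_scheme" and W :: "'v set"
  assumes V: "module K V" and W: "submodule W K V"
begin

interpretation V: module K V by (rule V)
interpretation W: submodule W K V by (rule W)
interpretation W: abelian_subgroup W V
  by (intro abelian_subgroupI3 additive_subgroup.intro W.subgroup_axioms V.abelian_group_axioms)

lemma coset_eq_iff: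
  assumes "x \<in> carrier V" and "y \<in> carrier V"
  shows "W +>\<^bsub>V\<^esub> x = W +>\<^bsub>V\<^esub> y \<longleftrightarrow> x \<ominus>\<^bsub>V\<^esub> y \<in> W"
proof
  assume "W +>\<^bsub>V\<^esub> x = W +>\<^bsub>V\<^esub> y"
  then have "x \<in> W +>\<^bsub>V\<^esub> y" using W.a_rcos_self[OF assms(1)] by simp
  then show "x \<ominus>\<^bsub>V\<^esub> y \<in> W" using W.a_rcos_module[OF assms(2,1)] by (simp add: a_minus_def)
next
  assume "x \<ominus>\<^bsub>V\<^esub> y \<in> W"
  then have "x \<in> W +>\<^bsub>V\<^esub> y" using W.a_rcos_module[OF assms(2,1)] by (simp add: a_minus_def)
  then show "W +>\<^bsub>V\<^esub> x = W +>\<^bsub>V\<^esub> y" using W.a_repr_independence' assms(2) by simp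
qed

lemma coset_self: "x \<in> carrier V \<Longrightarrow> x \<in> W +>\<^bsub>V\<^esub> x"
  by (rule W.a_rcos_self)

lemma coset_memD: "x \<in> carrier V \<Longrightarrow> y \<in> W +>\<^bsub>V\<^esub> x \<Longrightarrow> y \<in> carrier V \<and> W +>\<^bsub>V\<^esub> y = W +>\<^bsub>V\<^esub> x"
  using W.a_elemrcos_carrier W.a_repr_independence'[of y x] by blast

lemma carrier_quot_module: "carrier (quot_module V W) = (\<lambda>x. W +>\<^bsub>V\<^esub> x) ` carrier V"
  by (auto simp: quot_module_def A_RCOSETS_def')

lemma coset_add:
  "x \<in> carrier V \<Longrightarrow> y \<in> carrier V \<Longrightarrow>
    (W +>\<^bsub>V\<^esub> x) \<oplus>\<^bsub>quot_module V W\<^esub> (W +>\<^bsub>V\<^esub> y) = W +>\<^bsub>V\<^esub> (x \<oplus>\<^bsub>V\<^esub> y)"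
  by (simp add: quot_module_def W.a_rcos_sum)

text \<open>Scalar multiplication in the quotient is a union over all representatives. It collapses
  to one coset because \<open>W\<close> is stable under scalars, so all the united cosets coincide,
  and because a coset is nonempty.\<close>

lemma coset_smult:
  assumes "c \<in> carrier K" and "x \<in> carrier V"
  shows "c \<odot>\<^bsub>quot_module V W\<^esub> (W +>\<^bsub>V\<^esub> x) = W +>\<^bsub>V\<^esub> (c \<odot>\<^bsub>V\<^esub> x)"
proof -
  have "W +>\<^bsub>V\<^esub> (c \<odot>\<^bsub>V\<^esub> y) = W +>\<^bsub>V\<^esub> (c \<odot>\<^bsub>V\<^esub> x)" if "y \<in> W +>\<^bsub>V\<^esub> x" for y
  proof -
    have y: "y \<in> carrier V" and "W +>\<^bsub>V\<^esub> y = W +>\<^bsub>V\<^esub> x"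
      using coset_memD[OF assms(2) that] by blast+
    then have "y \<ominus>\<^bsub>V\<^esub> x \<in> W" using coset_eq_iff assms(2) by blast
    then have "c \<odot>\<^bsub>V\<^esub> (y \<ominus>\<^bsub>V\<^esub> x) \<in> W"
      using W.smult_closed[OF assms(1)] by blast
    moreover have "c \<odot>\<^bsub>V\<^esub> (y \<ominus>\<^bsub>V\<^esub> x) = c \<odot>\<^bsub>V\<^esub> y \<ominus>\<^bsub>V\<^esub> c \<odot>\<^bsub>V\<^esub> x"
      using y assms by (simp add: a_minus_def V.smult_r_distr V.smult_r_minus)
    ultimately have "c \<odot>\<^bsub>V\<^esub> y \<ominus>\<^bsub>V\<^esub> c \<odot>\<^bsub>V\<^esub> x \<in> W" by simp
    then show ?thesis using coset_eq_iff y assms by blast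
  qed
  then have "(\<Union>y\<in>W +>\<^bsub>V\<^esub> x. W +>\<^bsub>V\<^esub> (c \<odot>\<^bsub>V\<^esub> y)) = W +>\<^bsub>V\<^esub> (c \<odot>\<^bsub>V\<^esub> x)"
    using coset_self[OF assms(2)] by blast
  then show ?thesis by (simp add: quot_module_def)
qed

lemma module_quot_module: "module K (quot_module V W)"
proof (rule moduleI)
  \<comment> \<open>The record stores the zero as the bare set \<open>W\<close>; writing it as a
    coset lets every axiom be checked on representatives.\<close>
  have zero: "\<zero>\<^bsub>quot_module V W\<^esub> = W +>\<^bsub>V\<^esub> \<zero>\<^bsub>V\<^esub>"
    using V.a_coset_add_zero[OF W.a_subset] by (simp add: quot_module_def)
  show "abelian_group (quot_module V W)"
  proof (rule abelian_groupI)
    fix X assume "X \<in> carrier (quot_module V W)"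
    then obtain x where x: "x \<in> carrier V" "X = W +>\<^bsub>V\<^esub> x" by (auto simp: carrier_quot_module)
    then have "(W +>\<^bsub>V\<^esub> (\<ominus>\<^bsub>V\<^esub> x)) \<oplus>\<^bsub>quot_module V W\<^esub> X = \<zero>\<^bsub>quot_module V W\<^esub>"
      by (simp add: zero coset_add V.l_neg)
    then show "\<exists>Y\<in>carrier (quot_module V W). Y \<oplus>\<^bsub>quot_module V W\<^esub> X = \<zero>\<^bsub>quot_module V W\<^esub>"
      using x by (auto simp: carrier_quot_module)
  qed (auto simp: zero carrier_quot_module coset_add V.a_ac)
qed (auto simp: carrier_quot_module coset_add coset_smult V.smult_l_distr V.smult_r_distr
      V.smult_assoc1 V.cring_axioms)

lemma linear_map_coset: "linear_map K V (quot_module V W) (\<lambda>x. W +>\<^bsub>V\<^esub> x)"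
  by (auto simp: linear_map_def carrier_quot_module coset_add coset_smult)

end

section \<open>Free modules\<close>

context
  fixes K :: "('k, 'm) ring_scheme" and X :: "'x set"
  assumes K: "cring K"
begin

interpretation K: cring K by (rule K)

lemma free_module_apply_closed: "f \<in> carrier (free_module K X) \<Longrightarrow> f x \<in> carrier K"
  by (cases "x \<in> X") (auto simp: free_module_def)

lemma free_module_simps:
  "\<zero>\<^bsub>free_module K X\<^esub> = (\<lambda>_. \<zero>\<^bsub>K\<^esub>)"
  "f \<oplus>\<^bsub>free_module K X\<^esub> g = (\<lambda>x. f x \<oplus>\<^bsub>K\<^esub> g x)"
  "c \<odot>\<^bsub>free_module K X\<^esub> f = (\<lambda>x. c \<otimes>\<^bsub>K\<^esub> f x)"
  by (simp_all add: free_module_def)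

lemma module_free_module: "module K (free_module K X)"
proof (rule moduleI)
  show "abelian_group (free_module K X)"
  proof (rule abelian_groupI)
    fix f g assume "f \<in> carrier (free_module K X)" "g \<in> carrier (free_module K X)"
    then show "f \<oplus>\<^bsub>free_module K X\<^esub> g \<in> carrier (free_module K X)"
      by (auto simp: free_module_def
          intro: finite_subset[of _ "{x. f x \<noteq> \<zero>\<^bsub>K\<^esub>} \<union> {x. g x \<noteq> \<zero>\<^bsub>K\<^esub>}"])
  next
    fix f assume f: "f \<in> carrier (free_module K X)"
    have "(\<lambda>x. \<ominus>\<^bsub>K\<^esub> f x) \<in> carrier (free_module K X)"
      using f by (auto simp: free_module_def intro: finite_subset[of _ "{x. f x \<noteq> \<zero>\<^bsub>K\<^esub>}"])
    moreover have "(\<lambda>x. \<ominus>\<^bsub>K\<^esub> f x) \<oplus>\<^bsub>free_module K X\<^esub> f = \<zero>\<^bsub>free_module K X\<^esub>"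
      using free_module_apply_closed[OF f] by (simp add: free_module_simps K.l_neg)
    ultimately show "\<exists>g\<in>carrier (free_module K X).
        g \<oplus>\<^bsub>free_module K X\<^esub> f = \<zero>\<^bsub>free_module K X\<^esub>"
      by blast
  next
    show "\<zero>\<^bsub>free_module K X\<^esub> \<in> carrier (free_module K X)"
      by (simp add: free_module_def)
  qed (simp_all add: free_module_simps free_module_apply_closed K.a_ac)
next
  fix c f assume "c \<in> carrier K" "f \<in> carrier (free_module K X)"
  then show "c \<odot>\<^bsub>free_module K X\<^esub> f \<in> carrier (free_module K X)"
    by (auto simp: free_module_def intro: finite_subset[of _ "{x. f x \<noteq> \<zero>\<^bsub>K\<^esub>}"])
qed (simp_all add: K free_module_simps free_module_apply_closed K.l_distr K.r_distr K.m_assoc)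

lemma basis_vec_closed: "x \<in> X \<Longrightarrow> basis_vec K x \<in> carrier (free_module K X)"
  by (auto simp: free_module_def basis_vec_def)

text \<open>Elements have finite support. The induction is on a finite set \<open>Y\<close>
  containing the support and splits off one coordinate at a time.\<close>

lemma free_module_induct:
  assumes H: "submodule H K (free_module K X)"
    and basis: "\<And>x. x \<in> X \<Longrightarrow> basis_vec K x \<in> H"
    and f: "f \<in> carrier (free_module K X)"
  shows "f \<in> H"
proof -
  interpret F: module K "free_module K X" by (rule module_free_module)
  have "\<forall>f\<in>carrier (free_module K X). {x. f x \<noteq> \<zero>\<^bsub>K\<^esub>} \<subseteq> Y \<longrightarrow> f \<in> H" if "finite Y" for Y
    using that
  proof (induction Y)
    case empty
    have "\<zero>\<^bsub>free_module K X\<^esub> \<in> H"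
      by (rule zero_in_submodule[OF H])
    moreover have "f = \<zero>\<^bsub>free_module K X\<^esub>" if "{x. f x \<noteq> \<zero>\<^bsub>K\<^esub>} \<subseteq> {}" for f
      using that by (auto simp: free_module_def)
    ultimately show ?case by blast
  next
    case (insert y Y)
    show ?case
    proof (intro ballI impI)
      fix f assume f: "f \<in> carrier (free_module K X)" and sub: "{x. f x \<noteq> \<zero>\<^bsub>K\<^esub>} \<subseteq> insert y Y"
      let ?g = "f(y := \<zero>\<^bsub>K\<^esub>)"
      have g: "?g \<in> carrier (free_module K X)"
        using f by (auto simp: free_module_def intro: finite_subset[of _ "{x. f x \<noteq> \<zero>\<^bsub>K\<^esub>}"])
      have "{x. ?g x \<noteq> \<zero>\<^bsub>K\<^esub>} \<subseteq> Y" using sub by auto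
      then have "?g \<in> H" using g insert.IH by simp
      show "f \<in> H"
      proof (cases "y \<in> X")
        case True
        then have "f y \<odot>\<^bsub>free_module K X\<^esub> basis_vec K y \<in> H"
          using F.submoduleE(4)[OF H free_module_apply_closed[OF f] basis] by simp
        then have "f y \<odot>\<^bsub>free_module K X\<^esub> basis_vec K y \<oplus>\<^bsub>free_module K X\<^esub> ?g \<in> H"
          using F.submoduleE(5)[OF H _ \<open>?g \<in> H\<close>] by simp
        moreover have "f y \<odot>\<^bsub>free_module K X\<^esub> basis_vec K y \<oplus>\<^bsub>free_module K X\<^esub> ?g = f"
          using free_module_apply_closed[OF f] by (auto simp: free_module_def basis_vec_def)
        ultimately show ?thesis by simp
      next
        \<comment> \<open>\<open>Y\<close> may contain points outside \<open>X\<close>; there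
          \<open>f\<close> vanishes already and nothing is split off.\<close>
        case False
        then have "f = ?g" using f by (auto simp: free_module_def)
        then show ?thesis using \<open>?g \<in> H\<close> by simp
      qed
    qed
  qed
  moreover have "finite {x. f x \<noteq> \<zero>\<^bsub>K\<^esub>}" using f by (simp add: free_module_def)
  ultimately show ?thesis using f by blast
qed

text \<open>Uniqueness half of the universal property of the free module;
  \<open>linear_map_lin_ext\<close> is the existence half.\<close>

lemma linear_map_eq_on_free_module:
  assumes "module K W" and "linear_map K (free_module K X) W g" and "linear_map K (free_module K X) W h"
    and "\<And>x. x \<in> X \<Longrightarrow> g (basis_vec K x) = h (basis_vec K x)"
    and "f \<in> carrier (free_module K X)"
  shows "g f = h f"
  using free_module_induct[OF submodule_equalizer[OF module_free_module assms(1-3)] _ assms(5)]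
  by (simp add: basis_vec_closed assms(4))

section \<open>Linear extension from the basis\<close>

context
  fixes V :: "('k, 'v, 'n) module_scheme"
  assumes V: "module K V"
begin

interpretation V: module K V by (rule V)

text \<open>\<open>lin_ext\<close> sums over the exact support, which can shrink under addition and
  scaling. Padding with zero terms lets several vectors be summed over a common finite set.\<close>

lemma lin_ext_superset:
  assumes "f \<in> carrier (free_module K X)" and "h \<in> X \<rightarrow> carrier V"
    and "finite Y" and "{x. f x \<noteq> \<zero>\<^bsub>K\<^esub>} \<subseteq> Y" and "Y \<subseteq> X"
  shows "lin_ext K V h f = (\<Oplus>\<^bsub>V\<^esub>x\<in>Y. f x \<odot>\<^bsub>V\<^esub> h x)"
  unfolding lin_ext_def using assms(2-5) free_module_apply_closed[OF assms(1)]
  by (intro V.add.finprod_mono_neutral_cong_left) (auto simp: Pi_iff subset_iff)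

lemma lin_ext_basis_vec:
  assumes "h \<in> X \<rightarrow> carrier V" and "x \<in> X"
  shows "lin_ext K V h (basis_vec K x) = h x"
proof -
  have "lin_ext K V h (basis_vec K x) = (\<Oplus>\<^bsub>V\<^esub>y\<in>{x}. basis_vec K x y \<odot>\<^bsub>V\<^esub> h y)"
    using assms by (intro lin_ext_superset basis_vec_closed) (auto simp: basis_vec_def)
  then show ?thesis using assms by (simp add: basis_vec_def Pi_iff)
qed

lemma linear_map_lin_ext:
  assumes h: "h \<in> X \<rightarrow> carrier V"
  shows "linear_map K (free_module K X) V (lin_ext K V h)"
proof (rule linear_mapI)
  fix f assume f: "f \<in> carrier (free_module K X)"
  have supp: "finite {x. f x \<noteq> \<zero>\<^bsub>K\<^esub>}" "{x. f x \<noteq> \<zero>\<^bsub>K\<^esub>} \<subseteq> X"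
    using f by (auto simp: free_module_def)
  show "lin_ext K V h f \<in> carrier V"
    unfolding lin_ext_def using supp h free_module_apply_closed[OF f]
    by (intro V.finsum_closed) (auto simp: Pi_iff)
  show "lin_ext K V h (c \<odot>\<^bsub>free_module K X\<^esub> f) = c \<odot>\<^bsub>V\<^esub> lin_ext K V h f"
    if c: "c \<in> carrier K" for c
  proof -
    interpret F: module K "free_module K X" by (rule module_free_module)
    \<comment> \<open>The sum runs over the support of \<open>f\<close>, since that of the multiple
      is smaller when \<open>c\<close> is zero.\<close>
    have "lin_ext K V h (c \<odot>\<^bsub>free_module K X\<^esub> f)
        = (\<Oplus>\<^bsub>V\<^esub>x\<in>{x. f x \<noteq> \<zero>\<^bsub>K\<^esub>}. (c \<otimes>\<^bsub>K\<^esub> f x) \<odot>\<^bsub>V\<^esub> h x)"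
      using lin_ext_superset[OF F.smult_closed[OF c f] h supp(1) _ supp(2)] c
      by (simp add: free_module_def Collect_mono_iff) (metis K.r_null)
    also have "\<dots> = (\<Oplus>\<^bsub>V\<^esub>x\<in>{x. f x \<noteq> \<zero>\<^bsub>K\<^esub>}. c \<odot>\<^bsub>V\<^esub> (f x \<odot>\<^bsub>V\<^esub> h x))"
      using supp h free_module_apply_closed[OF f] c
      by (intro V.finsum_cong') (auto simp: V.smult_assoc1 Pi_iff)
    also have "\<dots> = c \<odot>\<^bsub>V\<^esub> lin_ext K V h f"
      unfolding lin_ext_def using supp h free_module_apply_closed[OF f] c
      by (intro V.finsum_smult_ldistr[symmetric]) (auto simp: Pi_iff)
    finally show ?thesis .
  qed
  show "lin_ext K V h (f \<oplus>\<^bsub>free_module K X\<^esub> g) = lin_ext K V h f \<oplus>\<^bsub>V\<^esub> lin_ext K V h g"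
    if g: "g \<in> carrier (free_module K X)" for g
  proof -
    interpret F: module K "free_module K X" by (rule module_free_module)
    \<comment> \<open>Cancellation can make the support of the sum smaller than this union, so all
      three sums are taken over the union.\<close>
    let ?Y = "{x. f x \<noteq> \<zero>\<^bsub>K\<^esub>} \<union> {x. g x \<noteq> \<zero>\<^bsub>K\<^esub>}"
    have Y: "finite ?Y" "?Y \<subseteq> X" using f g by (auto simp: free_module_def)
    have hY: "h x \<in> carrier V" if "x \<in> ?Y" for x using that Y h by auto
    have "lin_ext K V h (f \<oplus>\<^bsub>free_module K X\<^esub> g) = (\<Oplus>\<^bsub>V\<^esub>x\<in>?Y. (f x \<oplus>\<^bsub>K\<^esub> g x) \<odot>\<^bsub>V\<^esub> h x)"
      using lin_ext_superset[OF F.a_closed[OF f g] h Y(1) _ Y(2)]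
      by (simp add: free_module_def) (use K.l_zero[OF K.zero_closed] in force)
    also have "\<dots> = (\<Oplus>\<^bsub>V\<^esub>x\<in>?Y. f x \<odot>\<^bsub>V\<^esub> h x \<oplus>\<^bsub>V\<^esub> g x \<odot>\<^bsub>V\<^esub> h x)"
      using hY free_module_apply_closed[OF f] free_module_apply_closed[OF g]
      by (intro V.finsum_cong') (auto simp: V.smult_l_distr)
    also have "\<dots> = (\<Oplus>\<^bsub>V\<^esub>x\<in>?Y. f x \<odot>\<^bsub>V\<^esub> h x) \<oplus>\<^bsub>V\<^esub> (\<Oplus>\<^bsub>V\<^esub>x\<in>?Y. g x \<odot>\<^bsub>V\<^esub> h x)"
      using hY free_module_apply_closed[OF f] free_module_apply_closed[OF g]
      by (intro V.finsum_addf) auto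
    finally show ?thesis
      using lin_ext_superset[OF f h Y(1) _ Y(2)] lin_ext_superset[OF g h Y(1) _ Y(2)] by simp
  qed
qed

text \<open>Here the formal vector is fixed and the values on the basis vary. The index set of the
  sum does not depend on \<open>u\<close>, so linearity is checked term by term. This gives
  linearity of the product in its second factor, and of an evaluated relator in each
  variable.\<close>

lemma linear_map_lin_ext_param:
  assumes U: "module K U"
    and h: "\<And>x. x \<in> X \<Longrightarrow> linear_map K U V (\<lambda>u. h u x)"
    and f: "f \<in> carrier (free_module K X)"
  shows "linear_map K U V (\<lambda>u. lin_ext K V (h u) f)"
proof -
  interpret U: module K U by (rule U)
  have supp: "finite {x. f x \<noteq> \<zero>\<^bsub>K\<^esub>}" and X: "\<And>x. f x \<noteq> \<zero>\<^bsub>K\<^esub> \<Longrightarrow> x \<in> X"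
    using f by (auto simp: free_module_def)
  have fx: "f x \<in> carrier K" for x by (rule free_module_apply_closed[OF f])
  have clo: "h u x \<in> carrier V" if "u \<in> carrier U" "f x \<noteq> \<zero>\<^bsub>K\<^esub>" for u x
    using linear_map_closed[OF h[OF X]] that by blast
  show ?thesis
  proof (rule linear_mapI)
    fix u assume u: "u \<in> carrier U"
    show "lin_ext K V (h u) f \<in> carrier V"
      unfolding lin_ext_def using clo[OF u] fx by (intro V.finsum_closed) auto
    show "lin_ext K V (h (u \<oplus>\<^bsub>U\<^esub> u')) f = lin_ext K V (h u) f \<oplus>\<^bsub>V\<^esub> lin_ext K V (h u') f"
      if u': "u' \<in> carrier U" for u'
    proof -
      have "lin_ext K V (h (u \<oplus>\<^bsub>U\<^esub> u')) f
          = (\<Oplus>\<^bsub>V\<^esub>x\<in>{x. f x \<noteq> \<zero>\<^bsub>K\<^esub>}. f x \<odot>\<^bsub>V\<^esub> h u x \<oplus>\<^bsub>V\<^esub> f x \<odot>\<^bsub>V\<^esub> h u' x)"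
        unfolding lin_ext_def using clo[OF u] clo[OF u'] fx linear_map_add[OF h[OF X] u u']
        by (intro V.finsum_cong') (auto simp: V.smult_r_distr)
      then show ?thesis
        unfolding lin_ext_def using clo[OF u] clo[OF u'] fx by (simp add: Pi_iff V.finsum_addf)
    qed
    show "lin_ext K V (h (c \<odot>\<^bsub>U\<^esub> u)) f = c \<odot>\<^bsub>V\<^esub> lin_ext K V (h u) f"
      if c: "c \<in> carrier K" for c
    proof -
      have "lin_ext K V (h (c \<odot>\<^bsub>U\<^esub> u)) f
          = (\<Oplus>\<^bsub>V\<^esub>x\<in>{x. f x \<noteq> \<zero>\<^bsub>K\<^esub>}. c \<odot>\<^bsub>V\<^esub> (f x \<odot>\<^bsub>V\<^esub> h u x))"
        unfolding lin_ext_def using clo[OF u] fx c linear_map_smult[OF h[OF X] c u]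
        by (intro V.finsum_cong') (auto simp: K.m_comm simp flip: V.smult_assoc1)
      then show ?thesis
        unfolding lin_ext_def using clo[OF u] fx c supp
        by (simp add: Pi_iff V.finsum_smult_ldistr)
    qed
  qed
qed

end

end

section \<open>Tensor products\<close>

locale module_pair = A: module K A + B: module K B
  for K :: "('k, 'm) ring_scheme"
    and A :: "('k, 'a, 'p) module_scheme" and B :: "('k, 'b, 'q) module_scheme"
begin

abbreviation "F \<equiv> free_module K (carrier A \<times> carrier B)"
abbreviation "N \<equiv> tensor_relations K A B"
abbreviation "T \<equiv> tensor_module K A B"
abbreviation "proj f \<equiv> N +>\<^bsub>F\<^esub> f"
abbreviation "pure \<equiv> pure_tensor K A B"

lemmas pair_cring = A.R.cring_axioms
lemmas module_F = module_free_module[OF pair_cring, of "carrier A \<times> carrier B"]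
lemmas basis_closed = basis_vec_closed[OF pair_cring, of _ "carrier A \<times> carrier B"]

lemma submodule_tensor_relations: "submodule N K F"
proof -
  interpret F: module K F by (rule module_F)
  show ?thesis
    unfolding tensor_relations_def Let_def
    by (rule submodule_spanned[OF module_F])
      (auto simp: basis_closed intro!: F.minus_closed F.a_closed F.smult_closed)
qed

lemmas tensor_quotient_facts = module_F submodule_tensor_relations

lemma module_tensor: "module K T"
  unfolding tensor_module_def by (rule module_quot_module[OF tensor_quotient_facts])

lemma linear_map_proj: "linear_map K F T (\<lambda>f. proj f)"
  unfolding tensor_module_def by (rule linear_map_coset[OF tensor_quotient_facts])

lemma carrier_tensor: "carrier T = (\<lambda>f. proj f) ` carrier F"
  unfolding tensor_module_def by (rule carrier_quot_module[OF tensor_quotient_facts])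

lemma proj_eq_iff: "f \<in> carrier F \<Longrightarrow> g \<in> carrier F \<Longrightarrow> proj f = proj g \<longleftrightarrow> f \<ominus>\<^bsub>F\<^esub> g \<in> N"
  by (rule coset_eq_iff[OF tensor_quotient_facts])

text \<open>Additivity and homogeneity are the first and third families of generators of
  \<open>N\<close>; the second and fourth families give
  \<open>linear_map_pure_right\<close>.\<close>

lemma linear_map_pure_left:
  assumes "y \<in> carrier B"
  shows "linear_map K A T (\<lambda>x. pure x y)"
proof (rule linear_mapI)
  interpret F: module K F by (rule module_F)
  note lin = linear_map_closed[OF linear_map_proj] linear_map_add[OF linear_map_proj, symmetric]
    linear_map_smult[OF linear_map_proj, symmetric]
  fix x assume x: "x \<in> carrier A"
  show "pure x y \<in> carrier T"
    unfolding pure_tensor_def using x assms by (simp add: lin basis_closed)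
  show "pure (x \<oplus>\<^bsub>A\<^esub> x') y = pure x y \<oplus>\<^bsub>T\<^esub> pure x' y" if "x' \<in> carrier A" for x'
  proof -
    have "basis_vec K (x \<oplus>\<^bsub>A\<^esub> x', y) \<ominus>\<^bsub>F\<^esub> (basis_vec K (x, y) \<oplus>\<^bsub>F\<^esub> basis_vec K (x', y)) \<in> N"
      unfolding tensor_relations_def Let_def using x that assms by (intro spanned_inc) blast
    then show ?thesis
      unfolding pure_tensor_def using x that assms by (simp add: lin basis_closed proj_eq_iff)
  qed
  show "pure (c \<odot>\<^bsub>A\<^esub> x) y = c \<odot>\<^bsub>T\<^esub> pure x y" if "c \<in> carrier K" for c
  proof -
    have "basis_vec K (c \<odot>\<^bsub>A\<^esub> x, y) \<ominus>\<^bsub>F\<^esub> (c \<odot>\<^bsub>F\<^esub> basis_vec K (x, y)) \<in> N"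
      unfolding tensor_relations_def Let_def using x that assms by (intro spanned_inc) blast
    then show ?thesis
      unfolding pure_tensor_def using x that assms by (simp add: lin basis_closed proj_eq_iff)
  qed
qed

lemma linear_map_pure_right:
  assumes "x \<in> carrier A"
  shows "linear_map K B T (\<lambda>y. pure x y)"
proof (rule linear_mapI)
  interpret F: module K F by (rule module_F)
  note lin = linear_map_closed[OF linear_map_proj] linear_map_add[OF linear_map_proj, symmetric]
    linear_map_smult[OF linear_map_proj, symmetric]
  fix y assume y: "y \<in> carrier B"
  show "pure x y \<in> carrier T"
    unfolding pure_tensor_def using y assms by (simp add: lin basis_closed)
  show "pure x (y \<oplus>\<^bsub>B\<^esub> y') = pure x y \<oplus>\<^bsub>T\<^esub> pure x y'" if "y' \<in> carrier B" for y'
  proof -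
    have "basis_vec K (x, y \<oplus>\<^bsub>B\<^esub> y') \<ominus>\<^bsub>F\<^esub> (basis_vec K (x, y) \<oplus>\<^bsub>F\<^esub> basis_vec K (x, y')) \<in> N"
      unfolding tensor_relations_def Let_def using y that assms by (intro spanned_inc) blast
    then show ?thesis
      unfolding pure_tensor_def using y that assms by (simp add: lin basis_closed proj_eq_iff)
  qed
  show "pure x (c \<odot>\<^bsub>B\<^esub> y) = c \<odot>\<^bsub>T\<^esub> pure x y" if "c \<in> carrier K" for c
  proof -
    have "basis_vec K (x, c \<odot>\<^bsub>B\<^esub> y) \<ominus>\<^bsub>F\<^esub> (c \<odot>\<^bsub>F\<^esub> basis_vec K (x, y)) \<in> N"
      unfolding tensor_relations_def Let_def using y that assms by (intro spanned_inc) blast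
    then show ?thesis
      unfolding pure_tensor_def using y that assms by (simp add: lin basis_closed proj_eq_iff)
  qed
qed

section \<open>Spanning by pure tensors and maps out of the tensor product\<close>

lemma pure_closed: "x \<in> carrier A \<Longrightarrow> y \<in> carrier B \<Longrightarrow> pure x y \<in> carrier T"
  using linear_map_closed[OF linear_map_pure_left] by blast

text \<open>Pure tensors are the projections of the basis vectors, so the preimage of
  \<open>H\<close> under the projection contains a basis of \<open>F\<close>.\<close>

lemma tensor_induct:
  assumes H: "submodule H K T"
    and pure: "\<And>x y. x \<in> carrier A \<Longrightarrow> y \<in> carrier B \<Longrightarrow> pure x y \<in> H"
    and t: "t \<in> carrier T"
  shows "t \<in> H"
proof -
  obtain f where f: "f \<in> carrier F" "t = proj f" using t carrier_tensor by auto
  have "f \<in> {f \<in> carrier F. proj f \<in> H}"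
    by (rule free_module_induct[OF pair_cring
          submodule_preimage[OF module_F module_tensor linear_map_proj H] _ f(1)])
      (use pure in \<open>auto simp: basis_closed pure_tensor_def\<close>)
  then show ?thesis using f by simp
qed

text \<open>The universal property of the tensor product in kernel form: bilinearity of
  \<open>\<phi>\<close> kills the four families of generators, hence the submodule that they
  span.\<close>

lemma lin_ext_tensor_relations:
  assumes W: "module K W"
    and left: "\<And>y. y \<in> carrier B \<Longrightarrow> linear_map K A W (\<lambda>x. \<phi> x y)"
    and right: "\<And>x. x \<in> carrier A \<Longrightarrow> linear_map K B W (\<lambda>y. \<phi> x y)"
    and r: "r \<in> N"
  shows "lin_ext K W (\<lambda>(x, y). \<phi> x y) r = \<zero>\<^bsub>W\<^esub>"
proof -
  interpret W: module K W by (rule W)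
  interpret F: module K F by (rule module_F)
  let ?L = "lin_ext K W (\<lambda>(x, y). \<phi> x y)"
  have clo: "\<phi> x y \<in> carrier W" if "x \<in> carrier A" "y \<in> carrier B" for x y
    using linear_map_closed[OF left] that by blast
  then have h: "(\<lambda>(x, y). \<phi> x y) \<in> carrier A \<times> carrier B \<rightarrow> carrier W" by auto
  have L: "linear_map K F W ?L" by (rule linear_map_lin_ext[OF pair_cring W h])
  have L_basis: "?L (basis_vec K (x, y)) = \<phi> x y" if "x \<in> carrier A" "y \<in> carrier B" for x y
    using lin_ext_basis_vec[OF pair_cring W h, of "(x, y)"] that by simp
  note L_simps = linear_map_diff[OF module_F W L] linear_map_add[OF L] linear_map_smult[OF L]
    L_basis basis_closed
  have "N \<subseteq> {f \<in> carrier F. ?L f \<in> {\<zero>\<^bsub>W\<^esub>}}"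
    unfolding tensor_relations_def Let_def
  proof (rule spanned_least)
    show "submodule {f \<in> carrier F. ?L f \<in> {\<zero>\<^bsub>W\<^esub>}} K F"
      by (rule submodule_preimage[OF module_F W L submodule_zero[OF W]])
  qed (auto simp: L_simps clo linear_map_add[OF left] linear_map_add[OF right]
        linear_map_smult[OF left] linear_map_smult[OF right] W.r_neg a_minus_def[of W])
  then show ?thesis using r by blast
qed

text \<open>Induction on the set \<open>J\<close> of slots that may hold arbitrary tensors, all
  others being pure. To free one more slot, the rest is held fixed: vanishing is then a submodule
  condition on that slot, so \<open>tensor_induct\<close> brings it back to a pure entry.\<close>

lemma tensor_multilinear_eq_zero:
  fixes \<Phi> :: "('i \<Rightarrow> ('a \<times> 'b \<Rightarrow> 'k) set) \<Rightarrow> 'w" and W :: "('k, 'w, 'o) module_scheme"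
  assumes W: "module K W" and I: "finite I"
    and lin: "\<And>x n. x \<in> I \<rightarrow> carrier T \<Longrightarrow> n \<in> I \<Longrightarrow> linear_map K T W (\<lambda>u. \<Phi> (x(n := u)))"
    and pure: "\<And>x s t. s \<in> I \<rightarrow> carrier A \<Longrightarrow> t \<in> I \<rightarrow> carrier B \<Longrightarrow>
      (\<And>i. i \<in> I \<Longrightarrow> x i = pure (s i) (t i)) \<Longrightarrow> \<Phi> x = \<zero>\<^bsub>W\<^esub>"
    and x: "x \<in> I \<rightarrow> carrier T"
  shows "\<Phi> x = \<zero>\<^bsub>W\<^esub>"
proof -
  define P where "P = {pure s t | s t. s \<in> carrier A \<and> t \<in> carrier B}"
  have "\<forall>x. x \<in> I \<rightarrow> carrier T \<longrightarrow> (\<forall>i\<in>I - J. x i \<in> P) \<longrightarrow> \<Phi> x = \<zero>\<^bsub>W\<^esub>"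
    if "finite J" and "J \<subseteq> I" for J
    using that
  proof (induction J)
    case empty
    show ?case
    proof (intro allI impI)
      fix x assume "\<forall>i\<in>I - {}. x i \<in> P"
      then have "\<forall>i\<in>I. \<exists>s t. s \<in> carrier A \<and> t \<in> carrier B \<and> x i = pure s t"
        unfolding P_def by blast
      then obtain s t where "\<And>i. i \<in> I \<Longrightarrow> s i \<in> carrier A \<and> t i \<in> carrier B \<and> x i = pure (s i) (t i)"
        by metis
      then show "\<Phi> x = \<zero>\<^bsub>W\<^esub>" by (intro pure[of s t]) auto
    qed
  next
    case (insert j J)
    show ?case
    proof (intro allI impI)
      fix x assume x: "x \<in> I \<rightarrow> carrier T" and xP: "\<forall>i\<in>I - insert j J. x i \<in> P"
      have j: "j \<in> I" using insert.prems by simp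
      \<comment> \<open>Membership of \<open>x j\<close> itself is the claim, because
        \<open>x(j := x j)\<close> is \<open>x\<close>.\<close>
      have "x j \<in> {u \<in> carrier T. \<Phi> (x(j := u)) \<in> {\<zero>\<^bsub>W\<^esub>}}"
      proof (rule tensor_induct)
        show "submodule {u \<in> carrier T. \<Phi> (x(j := u)) \<in> {\<zero>\<^bsub>W\<^esub>}} K T"
          by (rule submodule_preimage[OF module_tensor W lin[OF x j] submodule_zero[OF W]])
        show "x j \<in> carrier T" using x j by blast
        fix s t assume st: "s \<in> carrier A" "t \<in> carrier B"
        then have "x(j := pure s t) \<in> I \<rightarrow> carrier T" using x pure_closed by auto
        moreover have "\<forall>i\<in>I - J. (x(j := pure s t)) i \<in> P" using xP st by (auto simp: P_def)
        ultimately have "\<Phi> (x(j := pure s t)) = \<zero>\<^bsub>W\<^esub>" using insert.IH insert.prems by simp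
        then show "pure s t \<in> {u \<in> carrier T. \<Phi> (x(j := u)) \<in> {\<zero>\<^bsub>W\<^esub>}}"
          using st pure_closed by simp
      qed
      then show "\<Phi> x = \<zero>\<^bsub>W\<^esub>" by simp
    qed
  qed
  from this[OF I] x show ?thesis by simp
qed

end

section \<open>The product on a tensor product of algebras\<close>

lemma bilinear_productI:
  assumes "\<And>y. y \<in> carrier A \<Longrightarrow> linear_map K A A (\<lambda>x. \<mu> x y)"
    and "\<And>x. x \<in> carrier A \<Longrightarrow> linear_map K A A (\<mu> x)"
  shows "bilinear_product K A \<mu>"
  using assms unfolding bilinear_product_def linear_map_def Pi_iff by blast

lemma bilinear_productD:
  assumes "bilinear_product K A \<mu>"
  shows "y \<in> carrier A \<Longrightarrow> linear_map K A A (\<lambda>x. \<mu> x y)"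
    and "x \<in> carrier A \<Longrightarrow> linear_map K A A (\<mu> x)"
    and "x \<in> carrier A \<Longrightarrow> y \<in> carrier A \<Longrightarrow> \<mu> x y \<in> carrier A"
  using assms unfolding bilinear_product_def linear_map_def Pi_iff by blast+

locale product_pair = module_pair K A B
  for K :: "('k, 'm) ring_scheme"
    and A :: "('k, 'a, 'p) module_scheme" and B :: "('k, 'b, 'q) module_scheme" +
  fixes \<mu> :: "'a \<Rightarrow> 'a \<Rightarrow> 'a" and \<nu> :: "'b \<Rightarrow> 'b \<Rightarrow> 'b"
  assumes bil_A: "bilinear_product K A \<mu>" and bil_B: "bilinear_product K B \<nu>"
begin

abbreviation "M \<equiv> tensor_product_map K A B \<mu> \<nu>"

text \<open>The body of \<open>tensor_product_map\<close> before projection. The extension in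
  \<open>s\<close> is the outer one and that in \<open>t\<close> the inner one, so linearity in
  \<open>s\<close> is immediate while linearity in \<open>t\<close> is linearity in a
  parameter.\<close>

definition free_product :: "('a \<times> 'b \<Rightarrow> 'k) \<Rightarrow> ('a \<times> 'b \<Rightarrow> 'k) \<Rightarrow> ('a \<times> 'b \<Rightarrow> 'k)" where
  "free_product s t =
    lin_ext K F (\<lambda>(x, y). lin_ext K F (\<lambda>(x', y'). basis_vec K (\<mu> x x', \<nu> y y')) t) s"

lemma basis_product_closed:
  assumes "x \<in> carrier A" and "y \<in> carrier B"
  shows "(\<lambda>(x', y'). basis_vec K (\<mu> x x', \<nu> y y')) \<in> carrier A \<times> carrier B \<rightarrow> carrier F"
  using assms bilinear_productD(3)[OF bil_A] bilinear_productD(3)[OF bil_B]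
  by (auto intro!: basis_closed)

lemma linear_map_row:
  assumes "x \<in> carrier A" and "y \<in> carrier B"
  shows "linear_map K F F (lin_ext K F (\<lambda>(x', y'). basis_vec K (\<mu> x x', \<nu> y y')))"
  by (rule linear_map_lin_ext[OF pair_cring module_F basis_product_closed[OF assms]])

lemma row_closed:
  assumes "t \<in> carrier F"
  shows "(\<lambda>(x, y). lin_ext K F (\<lambda>(x', y'). basis_vec K (\<mu> x x', \<nu> y y')) t)
    \<in> carrier A \<times> carrier B \<rightarrow> carrier F"
  using linear_map_closed[OF linear_map_row] assms by auto

lemma linear_map_free_product_left:
  assumes "t \<in> carrier F"
  shows "linear_map K F F (\<lambda>s. free_product s t)"
  unfolding free_product_def by (rule linear_map_lin_ext[OF pair_cring module_F row_closed[OF assms]])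

lemma linear_map_free_product_right:
  assumes "s \<in> carrier F"
  shows "linear_map K F F (\<lambda>t. free_product s t)"
  unfolding free_product_def
  by (rule linear_map_lin_ext_param[OF pair_cring module_F module_F _ assms])
    (auto simp: linear_map_row)

lemma free_product_closed: "s \<in> carrier F \<Longrightarrow> t \<in> carrier F \<Longrightarrow> free_product s t \<in> carrier F"
  using linear_map_closed[OF linear_map_free_product_left] by blast

lemma free_product_basis:
  assumes "x \<in> carrier A" "y \<in> carrier B" "x' \<in> carrier A" "y' \<in> carrier B"
  shows "free_product (basis_vec K (x, y)) (basis_vec K (x', y')) = basis_vec K (\<mu> x x', \<nu> y y')"
proof -
  have "free_product (basis_vec K (x, y)) (basis_vec K (x', y'))
      = lin_ext K F (\<lambda>(x', y'). basis_vec K (\<mu> x x', \<nu> y y')) (basis_vec K (x', y'))"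
    unfolding free_product_def
    using lin_ext_basis_vec[OF pair_cring module_F row_closed, of _ "(x, y)"] assms
    by (simp add: basis_closed)
  then show ?thesis
    using lin_ext_basis_vec[OF pair_cring module_F basis_product_closed, of x y "(x', y')"] assms
    by simp
qed

text \<open>This and \<open>proj_free_product_relation_right\<close> say that \<open>N\<close>
  behaves as a two-sided ideal. By linearity in \<open>t\<close> only multiplication by a basis
  vector has to be considered.\<close>

lemma proj_free_product_relation_left:
  assumes r: "r \<in> N" and t: "t \<in> carrier F"
  shows "proj (free_product r t) = \<zero>\<^bsub>T\<^esub>"
proof -
  interpret F: module K F by (rule module_F)
  have rF: "r \<in> carrier F" using F.submoduleE(1)[OF submodule_tensor_relations] r by blast
  have basis: "proj (free_product r (basis_vec K (u, v))) = \<zero>\<^bsub>T\<^esub>"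
    if u: "u \<in> carrier A" and v: "v \<in> carrier B" for u v
  proof -
    let ?\<phi> = "\<lambda>x y. pure (\<mu> x u) (\<nu> y v)"
    have clo: "\<mu> x u \<in> carrier A" "\<nu> y v \<in> carrier B" if "x \<in> carrier A" "y \<in> carrier B" for x y
      using bilinear_productD(3)[OF bil_A] bilinear_productD(3)[OF bil_B] u v that by auto
    have h: "(\<lambda>(x, y). ?\<phi> x y) \<in> carrier A \<times> carrier B \<rightarrow> carrier T"
      using clo by (auto intro!: pure_closed)
    \<comment> \<open>Basis vectors need not lie in \<open>N\<close>, so the two linear maps are
      compared on all of \<open>F\<close>; that \<open>r\<close> is a relation enters only in the
      next equation.\<close>
    have "proj (free_product r (basis_vec K (u, v))) = lin_ext K T (\<lambda>(x, y). ?\<phi> x y) r"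
    proof (rule linear_map_eq_on_free_module[OF pair_cring module_tensor _ _ _ rF])
      show "linear_map K F T (\<lambda>s. proj (free_product s (basis_vec K (u, v))))"
        using u v
        by (intro linear_map_comp[OF linear_map_free_product_left linear_map_proj]) (auto simp: basis_closed)
      show "linear_map K F T (lin_ext K T (\<lambda>(x, y). ?\<phi> x y))"
        by (rule linear_map_lin_ext[OF pair_cring module_tensor h])
    qed (use u v lin_ext_basis_vec[OF pair_cring module_tensor h] in
        \<open>auto simp: free_product_basis pure_tensor_def\<close>)
    also have "\<dots> = \<zero>\<^bsub>T\<^esub>"
      using clo u v
      by (intro lin_ext_tensor_relations[OF module_tensor _ _ r]
          linear_map_comp[OF bilinear_productD(1)[OF bil_A] linear_map_pure_left]
          linear_map_comp[OF bilinear_productD(1)[OF bil_B] linear_map_pure_right])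
    finally show ?thesis .
  qed
  have "t \<in> {t \<in> carrier F. proj (free_product r t) \<in> {\<zero>\<^bsub>T\<^esub>}}"
    by (rule free_module_induct[OF pair_cring submodule_preimage[OF module_F module_tensor
          linear_map_comp[OF linear_map_free_product_right[OF rF] linear_map_proj]
          submodule_zero[OF module_tensor]] _ t])
      (use basis in \<open>auto simp: basis_closed\<close>)
  then show ?thesis by simp
qed

lemma proj_free_product_relation_right:
  assumes r: "r \<in> N" and s: "s \<in> carrier F"
  shows "proj (free_product s r) = \<zero>\<^bsub>T\<^esub>"
proof -
  interpret F: module K F by (rule module_F)
  have rF: "r \<in> carrier F" using F.submoduleE(1)[OF submodule_tensor_relations] r by blast
  have basis: "proj (free_product (basis_vec K (u, v)) r) = \<zero>\<^bsub>T\<^esub>"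
    if u: "u \<in> carrier A" and v: "v \<in> carrier B" for u v
  proof -
    let ?\<phi> = "\<lambda>x y. pure (\<mu> u x) (\<nu> v y)"
    have clo: "\<mu> u x \<in> carrier A" "\<nu> v y \<in> carrier B" if "x \<in> carrier A" "y \<in> carrier B" for x y
      using bilinear_productD(3)[OF bil_A] bilinear_productD(3)[OF bil_B] u v that by auto
    have h: "(\<lambda>(x, y). ?\<phi> x y) \<in> carrier A \<times> carrier B \<rightarrow> carrier T"
      using clo by (auto intro!: pure_closed)
    have "proj (free_product (basis_vec K (u, v)) r) = lin_ext K T (\<lambda>(x, y). ?\<phi> x y) r"
    proof (rule linear_map_eq_on_free_module[OF pair_cring module_tensor _ _ _ rF])
      show "linear_map K F T (\<lambda>t. proj (free_product (basis_vec K (u, v)) t))"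
        using u v
        by (intro linear_map_comp[OF linear_map_free_product_right linear_map_proj]) (auto simp: basis_closed)
      show "linear_map K F T (lin_ext K T (\<lambda>(x, y). ?\<phi> x y))"
        by (rule linear_map_lin_ext[OF pair_cring module_tensor h])
    qed (use u v lin_ext_basis_vec[OF pair_cring module_tensor h] in
        \<open>auto simp: free_product_basis pure_tensor_def\<close>)
    also have "\<dots> = \<zero>\<^bsub>T\<^esub>"
      using clo u v
      by (intro lin_ext_tensor_relations[OF module_tensor _ _ r]
          linear_map_comp[OF bilinear_productD(2)[OF bil_A] linear_map_pure_left]
          linear_map_comp[OF bilinear_productD(2)[OF bil_B] linear_map_pure_right])
    finally show ?thesis .
  qed
  have "s \<in> {s \<in> carrier F. proj (free_product s r) \<in> {\<zero>\<^bsub>T\<^esub>}}"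
    by (rule free_module_induct[OF pair_cring submodule_preimage[OF module_F module_tensor
          linear_map_comp[OF linear_map_free_product_left[OF rF] linear_map_proj]
          submodule_zero[OF module_tensor]] _ s])
      (use basis in \<open>auto simp: basis_closed\<close>)
  then show ?thesis by simp
qed

text \<open>The factors are exchanged one at a time, passing through
  \<open>free_product s t'\<close>. Each exchange alters the product by a multiple of a
  relation.\<close>

lemma proj_free_product_cong:
  assumes s: "s \<in> carrier F" "s' \<in> carrier F" "proj s' = proj s"
    and t: "t \<in> carrier F" "t' \<in> carrier F" "proj t' = proj t"
  shows "proj (free_product s' t') = proj (free_product s t)"
proof -
  interpret T: module K T by (rule module_tensor)
  have eqI: "x = y" if "x \<ominus>\<^bsub>T\<^esub> y = \<zero>\<^bsub>T\<^esub>" "x \<in> carrier T" "y \<in> carrier T" for x y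
  proof -
    have "x = (x \<ominus>\<^bsub>T\<^esub> y) \<oplus>\<^bsub>T\<^esub> y" using that(2,3) by (simp add: a_minus_def T.a_assoc T.l_neg)
    then show ?thesis using that by simp
  qed
  have clo: "proj (free_product f g) \<in> carrier T" if "f \<in> carrier F" "g \<in> carrier F" for f g
    using that linear_map_closed[OF linear_map_proj] free_product_closed by blast
  note left = linear_map_comp[OF linear_map_free_product_left linear_map_proj]
  note right = linear_map_comp[OF linear_map_free_product_right linear_map_proj]
  have "s' \<ominus>\<^bsub>F\<^esub> s \<in> N" "t' \<ominus>\<^bsub>F\<^esub> t \<in> N" using proj_eq_iff s t by blast+
  have "proj (free_product s' t') \<ominus>\<^bsub>T\<^esub> proj (free_product s t') = \<zero>\<^bsub>T\<^esub>"
    using linear_map_diff[OF module_F module_tensor left[OF t(2)] s(2,1)]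
      proj_free_product_relation_left[OF \<open>s' \<ominus>\<^bsub>F\<^esub> s \<in> N\<close> t(2)] by simp
  moreover have "proj (free_product s t') \<ominus>\<^bsub>T\<^esub> proj (free_product s t) = \<zero>\<^bsub>T\<^esub>"
    using linear_map_diff[OF module_F module_tensor right[OF s(1)] t(2,1)]
      proj_free_product_relation_right[OF \<open>t' \<ominus>\<^bsub>F\<^esub> t \<in> N\<close> s(1)] by simp
  ultimately show ?thesis using eqI clo s t by (metis (no_types))
qed

text \<open>The union over representatives has equal members and is nonempty, hence is that one
  coset. From here on products are computed on chosen representatives.\<close>

lemma tensor_product_map_proj:
  assumes "s \<in> carrier F" and "t \<in> carrier F"
  shows "M (proj s) (proj t) = proj (free_product s t)"
proof -
  have "proj (free_product s' t') = proj (free_product s t)" if "s' \<in> proj s" "t' \<in> proj t" for s' t'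
    using coset_memD[OF tensor_quotient_facts assms(1) that(1)]
      coset_memD[OF tensor_quotient_facts assms(2) that(2)] assms
    by (intro proj_free_product_cong) blast+
  moreover have "s \<in> proj s" "t \<in> proj t"
    by (rule coset_self[OF tensor_quotient_facts assms(1)],
        rule coset_self[OF tensor_quotient_facts assms(2)])
  ultimately have "(\<Union>s'\<in>proj s. \<Union>t'\<in>proj t. proj (free_product s' t')) = proj (free_product s t)"
    by blast
  then show ?thesis unfolding tensor_product_map_def free_product_def by (simp add: Let_def)
qed

lemma tensor_product_map_pure:
  assumes "x \<in> carrier A" "x' \<in> carrier A" "y \<in> carrier B" "y' \<in> carrier B"
  shows "M (pure x y) (pure x' y') = pure (\<mu> x x') (\<nu> y y')"
  unfolding pure_tensor_def
  using assms by (simp add: tensor_product_map_proj basis_closed free_product_basis)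

lemma bilinear_tensor_product_map: "bilinear_product K T M"
proof (rule bilinear_productI)
  interpret F: module K F by (rule module_F)
  note left = linear_map_comp[OF linear_map_free_product_left linear_map_proj]
  note right = linear_map_comp[OF linear_map_free_product_right linear_map_proj]
  note proj_add = linear_map_add[OF linear_map_proj, symmetric]
  note proj_smult = linear_map_smult[OF linear_map_proj, symmetric]
  fix z assume "z \<in> carrier T"
  then obtain t where t: "t \<in> carrier F" "z = proj t" by (auto simp: carrier_tensor)
  show "linear_map K T T (\<lambda>w. M w z)"
    using linear_map_closed[OF left[OF t(1)]] linear_map_add[OF left[OF t(1)]]
      linear_map_smult[OF left[OF t(1)]] t
    by (intro linear_mapI)
      (auto simp: carrier_tensor proj_add proj_smult tensor_product_map_proj free_product_closed)
  show "linear_map K T T (M z)"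
    using linear_map_closed[OF right[OF t(1)]] linear_map_add[OF right[OF t(1)]]
      linear_map_smult[OF right[OF t(1)]] t
    by (intro linear_mapI)
      (auto simp: carrier_tensor proj_add proj_smult tensor_product_map_proj free_product_closed)
qed

text \<open>A swap of pure tensors swaps both factors: \<open>A\<close> contributes the scalar
  \<open>\<epsilon>\<close> and \<open>B\<close> contributes none. Keeping \<open>\<epsilon>\<close>
  general covers the commutative and the anticommutative case at once.\<close>

lemma tensor_product_map_symmetry:
  assumes \<epsilon>: "\<epsilon> \<in> carrier K"
    and A_sym: "\<And>x y. x \<in> carrier A \<Longrightarrow> y \<in> carrier A \<Longrightarrow> \<mu> x y = \<epsilon> \<odot>\<^bsub>A\<^esub> \<mu> y x"
    and B_sym: "\<And>x y. x \<in> carrier B \<Longrightarrow> y \<in> carrier B \<Longrightarrow> \<nu> x y = \<nu> y x"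
    and s: "s \<in> carrier T" and t: "t \<in> carrier T"
  shows "M s t = \<epsilon> \<odot>\<^bsub>T\<^esub> M t s"
proof -
  note left = bilinear_productD(1)[OF bilinear_tensor_product_map]
  note right = bilinear_productD(2)[OF bilinear_tensor_product_map]
  note scale = linear_map_scale[OF module_tensor \<epsilon>]
  have pures: "M (pure x y) (pure x' y') = \<epsilon> \<odot>\<^bsub>T\<^esub> M (pure x' y') (pure x y)"
    if "x \<in> carrier A" "y \<in> carrier B" "x' \<in> carrier A" "y' \<in> carrier B" for x y x' y'
  proof -
    have "M (pure x y) (pure x' y') = pure (\<epsilon> \<odot>\<^bsub>A\<^esub> \<mu> x' x) (\<nu> y' y)"
      unfolding tensor_product_map_pure[OF that(1,3,2,4)] A_sym[OF that(1,3)] B_sym[OF that(2,4)] ..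
    also have "\<dots> = \<epsilon> \<odot>\<^bsub>T\<^esub> pure (\<mu> x' x) (\<nu> y' y)"
      using that bilinear_productD(3)[OF bil_A] bilinear_productD(3)[OF bil_B]
      by (intro linear_map_smult[OF linear_map_pure_left \<epsilon>]) auto
    finally show ?thesis by (simp only: tensor_product_map_pure[OF that(3,1,4,2)])
  qed
  \<comment> \<open>Both sides are linear in each argument, so one argument is freed at a time: here
    \<open>s\<close> is arbitrary and the other argument is still pure.\<close>
  have half: "M s (pure x' y') = \<epsilon> \<odot>\<^bsub>T\<^esub> M (pure x' y') s"
    if xy: "x' \<in> carrier A" "y' \<in> carrier B" for x' y'
  proof -
    have "s \<in> {s \<in> carrier T. M s (pure x' y') = \<epsilon> \<odot>\<^bsub>T\<^esub> M (pure x' y') s}"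
      by (rule tensor_induct[OF submodule_equalizer[OF module_tensor module_tensor
            left[OF pure_closed[OF xy]] linear_map_comp[OF right[OF pure_closed[OF xy]] scale]] _ s])
        (use xy pures pure_closed in blast)
    then show ?thesis by simp
  qed
  have "t \<in> {t \<in> carrier T. M s t = \<epsilon> \<odot>\<^bsub>T\<^esub> M t s}"
    by (rule tensor_induct[OF submodule_equalizer[OF module_tensor module_tensor
          right[OF s] linear_map_comp[OF left[OF s] scale]] _ t])
      (use half pure_closed in blast)
  then show ?thesis by simp
qed

end

section \<open>Evaluation of monomials and relators\<close>

lemma monomials_cases:
  assumes "m \<in> monomials"
  obtains i j k where "{i, j, k} = {1, 2, 3}" and "m = LeftMono i j k \<or> m = RightMono i j k"
  using assms unfolding monomials_def Un_iff mem_Collect_eq by iprover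

text \<open>Each variable occurs exactly once in a monomial. This is what makes evaluation linear in
  every variable.\<close>

lemma distinct_of_triple_eq:
  assumes "{i, j, k} = {1, 2, 3 :: nat}"
  shows "i \<noteq> j" "i \<noteq> k" "j \<noteq> k"
proof -
  have "card {i, j, k} = 3" unfolding assms(1) by simp
  then show "i \<noteq> j" "i \<noteq> k" "j \<noteq> k" by (auto simp: card_insert_if split: if_splits)
qed

lemma eval_mono_closed:
  assumes "bilinear_product K A \<mu>" and "x \<in> {1, 2, 3} \<rightarrow> carrier A" and "m \<in> monomials"
  shows "eval_mono \<mu> x m \<in> carrier A"
proof -
  obtain i j k where ijk: "{i, j, k} = {1, 2, 3}" and m: "m = LeftMono i j k \<or> m = RightMono i j k"
    using assms(3) by (rule monomials_cases)
  have "x l \<in> carrier A" if "l \<in> {i, j, k}" for l using that assms(2) unfolding ijk by blast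
  then show ?thesis using m bilinear_productD(3)[OF assms(1)] by auto
qed

text \<open>Two bracketings and three positions of the variable give six cases. In each the
  dependence on \<open>u\<close> is a left or right multiplication, or a composite of two of
  them.\<close>

lemma linear_map_eval_mono:
  assumes bil: "bilinear_product K A \<mu>" and x: "x \<in> {1, 2, 3} \<rightarrow> carrier A"
    and m: "m \<in> monomials" and n: "n \<in> {1, 2, 3}"
  shows "linear_map K A A (\<lambda>u. eval_mono \<mu> (x(n := u)) m)"
proof -
  obtain i j k where ijk: "{i, j, k} = {1, 2, 3}"
    and m: "m = LeftMono i j k \<or> m = RightMono i j k"
    using m by (rule monomials_cases)
  note distinct = distinct_of_triple_eq[OF ijk]
  have "x l \<in> carrier A" if "l \<in> {i, j, k}" for l using that x unfolding ijk by blast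
  then have clo: "x i \<in> carrier A" "x j \<in> carrier A" "x k \<in> carrier A" by simp_all
  note l = bilinear_productD(1)[OF bil] and r = bilinear_productD(2)[OF bil]
    and c = bilinear_productD(3)[OF bil]
  have "n \<in> {i, j, k}" using n unfolding ijk .
  then show ?thesis
    using m distinct distinct[symmetric] l[OF clo(3)] r[OF clo(1)]
      linear_map_comp[OF l[OF clo(2)] l[OF clo(3)]] linear_map_comp[OF r[OF clo(1)] l[OF clo(3)]]
      r[OF c[OF clo(1,2)]] l[OF c[OF clo(2,3)]]
      linear_map_comp[OF l[OF clo(3)] r[OF clo(1)]] linear_map_comp[OF r[OF clo(2)] r[OF clo(1)]]
    by auto
qed

lemma act_mono_in_monomials:
  assumes "\<sigma> \<in> Sigma3"
  shows left_mono_in_monomials: "left_mono \<sigma> \<in> monomials"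
    and right_mono_in_monomials: "right_mono \<sigma> \<in> monomials"
proof -
  have "inv_into UNIV \<sigma> ` {1, 2, 3} = {1, 2, 3}"
    using assms permutes_image[OF permutes_inv] by (auto simp: Sigma3_def)
  then have "{inv_into UNIV \<sigma> 1, inv_into UNIV \<sigma> 2, inv_into UNIV \<sigma> 3} = {1, 2, 3}" by simp
  then show "left_mono \<sigma> \<in> monomials" and "right_mono \<sigma> \<in> monomials"
    unfolding left_mono_def right_mono_def monomials_def act_mono.simps by blast+
qed

section \<open>Relators as formal vectors and as identities\<close>

lemma relator_closed:
  assumes K: "cring K" and v: "v \<in> Sigma3 \<rightarrow> carrier K" and w: "w \<in> Sigma3 \<rightarrow> carrier K"
  shows "relator K v w \<in> carrier (free_module K monomials)"
proof -
  interpret F: module K "free_module K monomials" by (rule module_free_module[OF K])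
  show ?thesis
    unfolding relator_def Let_def using v w act_mono_in_monomials
    by (intro F.minus_closed F.finsum_closed) (auto intro!: basis_vec_closed[OF K] F.smult_closed)
qed

text \<open>The value function \<open>h\<close> is left general because it is used both for honest
  evaluation of monomials and for an evaluation whose factors in \<open>B\<close> have been
  replaced.\<close>

lemma lin_ext_relator:
  assumes V: "module K V" and h: "h \<in> monomials \<rightarrow> carrier V"
    and v: "v \<in> Sigma3 \<rightarrow> carrier K" and w: "w \<in> Sigma3 \<rightarrow> carrier K"
  shows "lin_ext K V h (relator K v w) =
      (\<Oplus>\<^bsub>V\<^esub>\<sigma>\<in>Sigma3. v \<sigma> \<odot>\<^bsub>V\<^esub> h (left_mono \<sigma>)) \<ominus>\<^bsub>V\<^esub> (\<Oplus>\<^bsub>V\<^esub>\<sigma>\<in>Sigma3. w \<sigma> \<odot>\<^bsub>V\<^esub> h (right_mono \<sigma>))"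
proof -
  interpret V: module K V by (rule V)
  have K: "cring K" by (rule V.R.cring_axioms)
  let ?F = "free_module K monomials"
  interpret F: module K ?F by (rule module_free_module[OF K])
  note L = linear_map_lin_ext[OF K V h]
  have clo: "v \<sigma> \<odot>\<^bsub>?F\<^esub> basis_vec K (left_mono \<sigma>) \<in> carrier ?F"
    "w \<sigma> \<odot>\<^bsub>?F\<^esub> basis_vec K (right_mono \<sigma>) \<in> carrier ?F" if "\<sigma> \<in> Sigma3" for \<sigma>
    using that v w act_mono_in_monomials by (auto intro!: basis_vec_closed[OF K] F.smult_closed)
  have val: "lin_ext K V h (v \<sigma> \<odot>\<^bsub>?F\<^esub> basis_vec K (left_mono \<sigma>)) = v \<sigma> \<odot>\<^bsub>V\<^esub> h (left_mono \<sigma>)"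
    "lin_ext K V h (w \<sigma> \<odot>\<^bsub>?F\<^esub> basis_vec K (right_mono \<sigma>)) = w \<sigma> \<odot>\<^bsub>V\<^esub> h (right_mono \<sigma>)"
    if "\<sigma> \<in> Sigma3" for \<sigma>
    using that v w act_mono_in_monomials
    by (simp_all add: linear_map_smult[OF L] lin_ext_basis_vec[OF K V h] basis_vec_closed[OF K] Pi_iff)
  have hclo: "v \<sigma> \<odot>\<^bsub>V\<^esub> h (left_mono \<sigma>) \<in> carrier V" "w \<sigma> \<odot>\<^bsub>V\<^esub> h (right_mono \<sigma>) \<in> carrier V"
    if "\<sigma> \<in> Sigma3" for \<sigma>
    using that v w h act_mono_in_monomials by (auto intro!: V.smult_closed)
  have "lin_ext K V h (relator K v w) =
      (\<Oplus>\<^bsub>V\<^esub>\<sigma>\<in>Sigma3. lin_ext K V h (v \<sigma> \<odot>\<^bsub>?F\<^esub> basis_vec K (left_mono \<sigma>))) \<ominus>\<^bsub>V\<^esub>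
      (\<Oplus>\<^bsub>V\<^esub>\<sigma>\<in>Sigma3. lin_ext K V h (w \<sigma> \<odot>\<^bsub>?F\<^esub> basis_vec K (right_mono \<sigma>)))"
    unfolding relator_def Let_def
    using clo
    by (simp add: linear_map_diff[OF F.module_axioms V L] linear_map_finsum[OF F.module_axioms V L]
        Pi_iff F.finsum_closed)
  also have "\<dots> = (\<Oplus>\<^bsub>V\<^esub>\<sigma>\<in>Sigma3. v \<sigma> \<odot>\<^bsub>V\<^esub> h (left_mono \<sigma>)) \<ominus>\<^bsub>V\<^esub>
      (\<Oplus>\<^bsub>V\<^esub>\<sigma>\<in>Sigma3. w \<sigma> \<odot>\<^bsub>V\<^esub> h (right_mono \<sigma>))"
    using val hclo by (intro arg_cong2[where f = "a_minus V"] V.finsum_cong') auto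
  finally show "lin_ext K V h (relator K v w) =
      (\<Oplus>\<^bsub>V\<^esub>\<sigma>\<in>Sigma3. v \<sigma> \<odot>\<^bsub>V\<^esub> h (left_mono \<sigma>)) \<ominus>\<^bsub>V\<^esub> (\<Oplus>\<^bsub>V\<^esub>\<sigma>\<in>Sigma3. w \<sigma> \<odot>\<^bsub>V\<^esub> h (right_mono \<sigma>))" .
qed

text \<open>Recasts an identity as the vanishing of a linear map at a fixed vector, so that maps
  agreeing on monomials can be exchanged.\<close>

lemma operad_algebra_iff:
  assumes coeffs: "\<forall>p\<in>{1..k}. a p \<in> Sigma3 \<rightarrow> carrier K \<and> b p \<in> Sigma3 \<rightarrow> carrier K"
  shows "operad_algebra K E k a b A \<mu> \<longleftrightarrow>
    module K A \<and> bilinear_product K A \<mu> \<and> has_symmetry E A \<mu> \<and>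
    (\<forall>p\<in>{1..k}. \<forall>x\<in>{1, 2, 3} \<rightarrow> carrier A.
      lin_ext K A (eval_mono \<mu> x) (relator K (a p) (b p)) = \<zero>\<^bsub>A\<^esub>)"
proof -
  have eval: "lin_ext K A (eval_mono \<mu> x) (relator K (a p) (b p)) =
      (\<Oplus>\<^bsub>A\<^esub>\<sigma>\<in>Sigma3. a p \<sigma> \<odot>\<^bsub>A\<^esub>
         \<mu> (\<mu> (x (inv_into UNIV \<sigma> 1)) (x (inv_into UNIV \<sigma> 2))) (x (inv_into UNIV \<sigma> 3))) \<ominus>\<^bsub>A\<^esub>
      (\<Oplus>\<^bsub>A\<^esub>\<sigma>\<in>Sigma3. b p \<sigma> \<odot>\<^bsub>A\<^esub>
         \<mu> (x (inv_into UNIV \<sigma> 1)) (\<mu> (x (inv_into UNIV \<sigma> 2)) (x (inv_into UNIV \<sigma> 3))))"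
    if "module K A" "bilinear_product K A \<mu>" "p \<in> {1..k}" "x \<in> {1, 2, 3} \<rightarrow> carrier A" for p x
    using lin_ext_relator[OF that(1), of "eval_mono \<mu> x" "a p" "b p"] coeffs that(3)
      eval_mono_closed[OF that(2,4)]
    by (simp add: left_mono_def right_mono_def)
  then show ?thesis 
    \<comment> \<open>\<open>eval\<close> presupposes the module and bilinearity conjuncts;
      \<open>conj_cong\<close> supplies them while the last conjunct is rewritten.\<close>
    unfolding operad_algebra_def by (intro conj_cong ball_cong refl) (simp only: eval)
qed

context product_pair
begin

lemma eval_mono_pure:
  assumes "s \<in> {1, 2, 3} \<rightarrow> carrier A" and "t \<in> {1, 2, 3} \<rightarrow> carrier B" and "m \<in> monomials"
    and "\<And>i. i \<in> {1, 2, 3} \<Longrightarrow> x i = pure (s i) (t i)"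
  shows "eval_mono M x m = pure (eval_mono \<mu> s m) (eval_mono \<nu> t m)"
proof -
  obtain i j k where ijk: "{i, j, k} = {1, 2, 3}" and m: "m = LeftMono i j k \<or> m = RightMono i j k"
    using assms(3) by (rule monomials_cases)
  have "s l \<in> carrier A \<and> t l \<in> carrier B \<and> x l = pure (s l) (t l)" if "l \<in> {i, j, k}" for l
    using that assms(1,2,4) unfolding ijk by blast
  then show ?thesis
    using m bilinear_productD(3)[OF bil_A] bilinear_productD(3)[OF bil_B]
    by (auto simp: tensor_product_map_pure)
qed

text \<open>All that is used of \<open>B\<close> is \<open>common\<close>: for given arguments, the
  monomials occurring in the relator share one value. That value may vary with the arguments
  \<open>t\<close>, so it is chosen only after the reduction to pure tensors.\<close>

lemma relator_tensor_product_map: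
  assumes v: "v \<in> Sigma3 \<rightarrow> carrier K" and w: "w \<in> Sigma3 \<rightarrow> carrier K"
    and A_zero: "\<And>s. s \<in> {1, 2, 3} \<rightarrow> carrier A \<Longrightarrow>
      lin_ext K A (eval_mono \<mu> s) (relator K v w) = \<zero>\<^bsub>A\<^esub>"
    and common: "\<And>t. t \<in> {1, 2, 3} \<rightarrow> carrier B \<Longrightarrow>
      \<exists>z\<in>carrier B. \<forall>\<sigma>\<in>Sigma3.
        (v \<sigma> \<noteq> \<zero>\<^bsub>K\<^esub> \<longrightarrow> eval_mono \<nu> t (left_mono \<sigma>) = z) \<and>
        (w \<sigma> \<noteq> \<zero>\<^bsub>K\<^esub> \<longrightarrow> eval_mono \<nu> t (right_mono \<sigma>) = z)"
    and x: "x \<in> {1, 2, 3} \<rightarrow> carrier T"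
  shows "lin_ext K T (eval_mono M x) (relator K v w) = \<zero>\<^bsub>T\<^esub>"
proof (rule tensor_multilinear_eq_zero[OF module_tensor _ _ _ x])
  interpret T: module K T by (rule module_tensor)
  show "finite {1, 2, 3 :: nat}" by simp
  note F = relator_closed[OF pair_cring v w]
  show "linear_map K T T (\<lambda>u. lin_ext K T (eval_mono M (x(n := u))) (relator K v w))"
    if "x \<in> {1, 2, 3} \<rightarrow> carrier T" "n \<in> {1, 2, 3}" for x n
    by (rule linear_map_lin_ext_param[OF pair_cring module_tensor module_tensor _ F])
      (rule linear_map_eval_mono[OF bilinear_tensor_product_map that(1) _ that(2)])
  fix x :: "nat \<Rightarrow> ('a \<times> 'b \<Rightarrow> 'k) set" and s :: "nat \<Rightarrow> 'a" and t :: "nat \<Rightarrow> 'b"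
  assume s: "s \<in> {1, 2, 3} \<rightarrow> carrier A" and t: "t \<in> {1, 2, 3} \<rightarrow> carrier B"
    and xst: "\<And>i. i \<in> {1, 2, 3} \<Longrightarrow> x i = pure (s i) (t i)"
  have ev: "eval_mono M x m = pure (eval_mono \<mu> s m) (eval_mono \<nu> t m)" if "m \<in> monomials" for m
    by (rule eval_mono_pure[OF s t that xst])
  have evA: "eval_mono \<mu> s m \<in> carrier A" and evB: "eval_mono \<nu> t m \<in> carrier B"
    if "m \<in> monomials" for m
    using that eval_mono_closed[OF bil_A s] eval_mono_closed[OF bil_B t] by blast+
  obtain z where z: "z \<in> carrier B"
    and vz: "\<And>\<sigma>. \<sigma> \<in> Sigma3 \<Longrightarrow> v \<sigma> \<noteq> \<zero>\<^bsub>K\<^esub> \<Longrightarrow> eval_mono \<nu> t (left_mono \<sigma>) = z"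
    and wz: "\<And>\<sigma>. \<sigma> \<in> Sigma3 \<Longrightarrow> w \<sigma> \<noteq> \<zero>\<^bsub>K\<^esub> \<Longrightarrow> eval_mono \<nu> t (right_mono \<sigma>) = z"
    using common[OF t] by blast
  \<comment> \<open>The factor in \<open>B\<close> is set to \<open>z\<close> for every monomial,
    occurring or not, which makes \<open>?h\<close> the composite of evaluation in \<open>A\<close>
    with a linear map.\<close>
  let ?h = "\<lambda>m. pure (eval_mono \<mu> s m) z"
  have hclo: "?h \<in> monomials \<rightarrow> carrier T" using evA z pure_closed by auto
  have xclo: "eval_mono M x \<in> monomials \<rightarrow> carrier T" using ev evA evB pure_closed by auto
  \<comment> \<open>With a zero coefficient both sides vanish whatever the value in
    \<open>B\<close>; otherwise the value in \<open>B\<close> is \<open>z\<close>.\<close>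
  have v_eq: "v \<sigma> \<odot>\<^bsub>T\<^esub> eval_mono M x (left_mono \<sigma>) = v \<sigma> \<odot>\<^bsub>T\<^esub> ?h (left_mono \<sigma>)"
    and w_eq: "w \<sigma> \<odot>\<^bsub>T\<^esub> eval_mono M x (right_mono \<sigma>) = w \<sigma> \<odot>\<^bsub>T\<^esub> ?h (right_mono \<sigma>)"
    if "\<sigma> \<in> Sigma3" for \<sigma>
    using funcset_mem[OF xclo act_mono_in_monomials(1)[OF that]]
      funcset_mem[OF xclo act_mono_in_monomials(2)[OF that]]
      funcset_mem[OF hclo act_mono_in_monomials(1)[OF that]]
      funcset_mem[OF hclo act_mono_in_monomials(2)[OF that]]
      ev[OF act_mono_in_monomials(1)[OF that]] ev[OF act_mono_in_monomials(2)[OF that]]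
      vz[OF that] wz[OF that]
    by (cases "v \<sigma> = \<zero>\<^bsub>K\<^esub>"; cases "w \<sigma> = \<zero>\<^bsub>K\<^esub>"; simp)+
  have h_closed: "v \<sigma> \<odot>\<^bsub>T\<^esub> ?h (left_mono \<sigma>) \<in> carrier T" "w \<sigma> \<odot>\<^bsub>T\<^esub> ?h (right_mono \<sigma>) \<in> carrier T"
    if "\<sigma> \<in> Sigma3" for \<sigma>
    using that v w act_mono_in_monomials hclo by (auto intro!: T.smult_closed)
  note sA = linear_map_lin_ext[OF pair_cring A.module_axioms, of "eval_mono \<mu> s" monomials]
  have "lin_ext K T (eval_mono M x) (relator K v w) = lin_ext K T ?h (relator K v w)"
    unfolding lin_ext_relator[OF module_tensor xclo v w] lin_ext_relator[OF module_tensor hclo v w]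
    using v_eq w_eq h_closed by (intro arg_cong2[where f = "a_minus T"] T.finsum_cong') auto
  \<comment> \<open>Both sides are linear in the formal vector and agree on monomials, so the
    relator may be moved inside the first tensor factor.\<close>
  also have "\<dots> = pure (lin_ext K A (eval_mono \<mu> s) (relator K v w)) z"
  proof (rule linear_map_eq_on_free_module[OF pair_cring module_tensor _ _ _ F])
    show "linear_map K (free_module K monomials) T (lin_ext K T ?h)"
      by (rule linear_map_lin_ext[OF pair_cring module_tensor hclo])
    show "linear_map K (free_module K monomials) T (\<lambda>f. pure (lin_ext K A (eval_mono \<mu> s) f) z)"
      using evA by (intro linear_map_comp[OF sA linear_map_pure_left[OF z]]) auto
  next
    fix m assume m: "m \<in> monomials"
    show "lin_ext K T ?h (basis_vec K m) = pure (lin_ext K A (eval_mono \<mu> s) (basis_vec K m)) z"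
      using lin_ext_basis_vec[OF pair_cring module_tensor hclo m]
        lin_ext_basis_vec[OF pair_cring A.module_axioms _ m, of "eval_mono \<mu> s"] evA by auto
  qed
  also have "\<dots> = \<zero>\<^bsub>T\<^esub>"
    unfolding A_zero[OF s]
    by (rule linear_map_zero[OF A.module_axioms module_tensor linear_map_pure_left[OF z]])
  finally show "lin_ext K T (eval_mono M x) (relator K v w) = \<zero>\<^bsub>T\<^esub>" .
qed

end

section \<open>The relations of the associated operad\<close>

text \<open>A span always contains zero, so a coset contains the vector that names it, for each kind
  of generators.\<close>

lemma cls_self:
  assumes "cring K" and "f \<in> carrier (free_module K monomials)"
  shows "f \<in> cls K E f"
proof -
  interpret F: module K "free_module K monomials" by (rule module_free_module[OF assms(1)])
  have "\<zero>\<^bsub>free_module K monomials\<^esub> \<in> symmetry_relations K E"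
    unfolding symmetry_relations_def Let_def by (rule zero_in_spanned)
  moreover have "f = \<zero>\<^bsub>free_module K monomials\<^esub> \<oplus>\<^bsub>free_module K monomials\<^esub> f"
    using assms(2) by simp
  ultimately show ?thesis unfolding cls_def a_r_coset_def' by auto
qed

lemma act_free_id:
  assumes "cring K" and "f \<in> carrier (free_module K monomials)"
  shows "act_free K id f = f"
proof -
  have F: "module K (free_module K monomials)" by (rule module_free_module[OF assms(1)])
  have act: "act_mono id m = m" for m by (cases m) (simp_all add: inv_id)
  have h: "(\<lambda>m. basis_vec K (act_mono id m)) \<in> monomials \<rightarrow> carrier (free_module K monomials)"
    using basis_vec_closed[OF assms(1)] by (auto simp: act)
  show ?thesis
    unfolding act_free_def
    by (rule linear_map_eq_on_free_module[OF assms(1) F linear_map_lin_ext[OF assms(1) F h]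
          linear_map_ident _ assms(2)])
      (use lin_ext_basis_vec[OF assms(1) F h] in \<open>simp add: act\<close>)
qed

text \<open>Identities are imposed through all representatives, so it suffices to find one element
  of the orbit span that contains the explicit vector \<open>f\<close>. The image of its class under
  the identity permutation is such an element.\<close>

lemma orbit_span_inc:
  assumes "cring K" and "f \<in> carrier (free_module K monomials)" and "cls K E f \<in> S"
  shows "\<exists>r\<in>orbit_span K E S. f \<in> r"
proof
  show "f \<in> act_free K id ` cls K E f"
    using cls_self[OF assms(1,2)] act_free_id[OF assms(1,2)] by (metis imageI)
  have "id \<in> Sigma3" unfolding Sigma3_def using permutes_id by blast
  then show "act_free K id ` cls K E f \<in> orbit_span K E S"
    unfolding orbit_span_def orbit_union_def using assms(3) by (intro spanned_inc) blast
qed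

text \<open>Over a field the nonzero scalar in a generator of the associated relations can be cancelled.\<close>

lemma tilde_monomials_eq:
  assumes K: "field K" and alg: "tilde_operad_algebra K E k a b B \<nu>"
    and y: "y \<in> {1, 2, 3} \<rightarrow> carrier B"
    and c: "c \<in> carrier K" "d \<in> carrier K" "c \<noteq> \<zero>\<^bsub>K\<^esub>" "d \<noteq> \<zero>\<^bsub>K\<^esub>"
    and m: "m \<in> monomials" "m' \<in> monomials"
    and S: "tilde_relations K E k a b = orbit_span K (tilde_generators E) S"
    and inS: "cls K (tilde_generators E) ((c \<otimes>\<^bsub>K\<^esub> d) \<odot>\<^bsub>free_module K monomials\<^esub>
      (basis_vec K m \<ominus>\<^bsub>free_module K monomials\<^esub> basis_vec K m')) \<in> S"
  shows "eval_mono \<nu> y m = eval_mono \<nu> y m'"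
proof -
  interpret K: field K by (rule K)
  have cring: "cring K" by (rule K.cring_axioms)
  have modB: "module K B" and bil: "bilinear_product K B \<nu>"
    using alg by (auto simp: tilde_operad_algebra_def)
  interpret B: module K B by (rule modB)
  let ?F = "free_module K monomials"
  interpret F: module K ?F by (rule module_free_module[OF cring])
  let ?e = "c \<otimes>\<^bsub>K\<^esub> d" and ?f = "basis_vec K m \<ominus>\<^bsub>?F\<^esub> basis_vec K m'"
  have cd: "?e \<in> carrier K" "?e \<noteq> \<zero>\<^bsub>K\<^esub>" using c by (simp_all add: K.integral_iff)
  then have "?e \<in> Units K" by (simp add: K.field_Units)
  note inv = K.Units_inv_closed[OF this] K.Units_l_inv[OF this]
  have ev: "eval_mono \<nu> y \<in> monomials \<rightarrow> carrier B" by (intro Pi_I eval_mono_closed[OF bil y])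
  note L = linear_map_lin_ext[OF cring modB ev]
  have basis: "basis_vec K m \<in> carrier ?F" "basis_vec K m' \<in> carrier ?F"
    by (rule basis_vec_closed[OF cring m(1)], rule basis_vec_closed[OF cring m(2)])
  then have f: "?f \<in> carrier ?F" by (rule F.minus_closed)
  have diff: "eval_mono \<nu> y m \<ominus>\<^bsub>B\<^esub> eval_mono \<nu> y m' \<in> carrier B"
    using ev m by (intro B.minus_closed) auto
  obtain r where "r \<in> tilde_relations K E k a b" "?e \<odot>\<^bsub>?F\<^esub> ?f \<in> r"
    using orbit_span_inc[OF cring F.smult_closed[OF cd(1) f] inS] unfolding S by (elim bexE)
  then have "lin_ext K B (eval_mono \<nu> y) (?e \<odot>\<^bsub>?F\<^esub> ?f) = \<zero>\<^bsub>B\<^esub>"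
    using alg y unfolding tilde_operad_algebra_def by blast
  then have "?e \<odot>\<^bsub>B\<^esub> (eval_mono \<nu> y m \<ominus>\<^bsub>B\<^esub> eval_mono \<nu> y m') = \<zero>\<^bsub>B\<^esub>"
    using linear_map_smult[OF L cd(1) f] linear_map_diff[OF F.module_axioms modB L basis]
      lin_ext_basis_vec[OF cring modB ev m(1)] lin_ext_basis_vec[OF cring modB ev m(2)] by simp
  then have "(inv\<^bsub>K\<^esub> ?e \<otimes>\<^bsub>K\<^esub> ?e) \<odot>\<^bsub>B\<^esub> (eval_mono \<nu> y m \<ominus>\<^bsub>B\<^esub> eval_mono \<nu> y m') = \<zero>\<^bsub>B\<^esub>"
    using B.smult_assoc1[OF inv(1) cd(1) diff] inv(1) by simp
  then have zero: "eval_mono \<nu> y m \<ominus>\<^bsub>B\<^esub> eval_mono \<nu> y m' = \<zero>\<^bsub>B\<^esub>" using inv(2) diff by simp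
  have "eval_mono \<nu> y m = (eval_mono \<nu> y m \<ominus>\<^bsub>B\<^esub> eval_mono \<nu> y m') \<oplus>\<^bsub>B\<^esub> eval_mono \<nu> y m'"
    using ev m by (simp add: a_minus_def B.a_assoc B.l_neg Pi_iff)
  also have "\<dots> = eval_mono \<nu> y m'" using zero ev m by (simp add: Pi_iff)
  finally show ?thesis .
qed

text \<open>Any occurring monomial can provide \<open>z\<close>. The two unmixed families of
  relations compare monomials of the same bracketing, and the mixed family carries the value from
  one bracketing to the other.\<close>

lemma tilde_common_value:
  assumes K: "field K" and alg: "tilde_operad_algebra K E k a b B \<nu>"
    and p: "p \<in> {1..k}"
    and a: "a p \<in> Sigma3 \<rightarrow> carrier K" and b: "b p \<in> Sigma3 \<rightarrow> carrier K"
    and y: "y \<in> {1, 2, 3} \<rightarrow> carrier B"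
  shows "\<exists>z\<in>carrier B. \<forall>\<sigma>\<in>Sigma3.
    (a p \<sigma> \<noteq> \<zero>\<^bsub>K\<^esub> \<longrightarrow> eval_mono \<nu> y (left_mono \<sigma>) = z) \<and>
    (b p \<sigma> \<noteq> \<zero>\<^bsub>K\<^esub> \<longrightarrow> eval_mono \<nu> y (right_mono \<sigma>) = z)"
proof -
  have modB: "module K B" and bil: "bilinear_product K B \<nu>"
    using alg by (auto simp: tilde_operad_algebra_def)
  interpret B: module K B by (rule modB)
  \<comment> \<open>The set \<open>S\<close> of \<open>tilde_monomials_eq\<close> becomes the union
    of the three families of generators. What remains each time is to pick the right family, which
    the \<open>UnI1\<close> and \<open>UnI2\<close> steps do.\<close>
  note eq = tilde_monomials_eq[OF K alg y _ _ _ _ _ _ tilde_relations_def[unfolded Let_def]]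
  note av = funcset_mem[OF a] and bv = funcset_mem[OF b]
    and lm = left_mono_in_monomials and rm = right_mono_in_monomials
  have aa: "eval_mono \<nu> y (left_mono \<sigma>) = eval_mono \<nu> y (left_mono \<tau>)"
    if "\<sigma> \<in> Sigma3" "\<tau> \<in> Sigma3" "a p \<sigma> \<noteq> \<zero>\<^bsub>K\<^esub>" "a p \<tau> \<noteq> \<zero>\<^bsub>K\<^esub>" for \<sigma> \<tau>
    by (rule eq[OF av[OF that(1)] av[OF that(2)] that(3,4) lm[OF that(1)] lm[OF that(2)]],
        rule UnI1, rule UnI1, intro CollectI exI conjI, rule refl, (rule p that)+)
  have bb: "eval_mono \<nu> y (right_mono \<sigma>) = eval_mono \<nu> y (right_mono \<tau>)"
    if "\<sigma> \<in> Sigma3" "\<tau> \<in> Sigma3" "b p \<sigma> \<noteq> \<zero>\<^bsub>K\<^esub>" "b p \<tau> \<noteq> \<zero>\<^bsub>K\<^esub>" for \<sigma> \<tau>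
    by (rule eq[OF bv[OF that(1)] bv[OF that(2)] that(3,4) rm[OF that(1)] rm[OF that(2)]],
        rule UnI1, rule UnI2, intro CollectI exI conjI, rule refl, (rule p that)+)
  have ab: "eval_mono \<nu> y (left_mono \<sigma>) = eval_mono \<nu> y (right_mono \<tau>)"
    if "\<sigma> \<in> Sigma3" "\<tau> \<in> Sigma3" "a p \<sigma> \<noteq> \<zero>\<^bsub>K\<^esub>" "b p \<tau> \<noteq> \<zero>\<^bsub>K\<^esub>" for \<sigma> \<tau>
    by (rule eq[OF av[OF that(1)] bv[OF that(2)] that(3,4) lm[OF that(1)] rm[OF that(2)]],
        rule UnI2, intro CollectI exI conjI, rule refl, (rule p that)+)
  have clo: "eval_mono \<nu> y m \<in> carrier B" if "m \<in> monomials" for m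
    using eval_mono_closed[OF bil y that] .
  consider \<sigma> where "\<sigma> \<in> Sigma3" "a p \<sigma> \<noteq> \<zero>\<^bsub>K\<^esub>"
    | \<sigma> where "\<sigma> \<in> Sigma3" "b p \<sigma> \<noteq> \<zero>\<^bsub>K\<^esub>"
    | "\<forall>\<sigma>\<in>Sigma3. a p \<sigma> = \<zero>\<^bsub>K\<^esub> \<and> b p \<sigma> = \<zero>\<^bsub>K\<^esub>"
    by blast
  then show ?thesis
  proof cases
    case 1
    show ?thesis
      by (rule bexI[OF _ clo[OF lm[OF 1(1)]]], intro ballI conjI impI)
        (rule aa[OF _ 1(1) _ 1(2)] ab[OF 1(1) _ 1(2), symmetric]; assumption)+
  next
    case 2
    show ?thesis
      by (rule bexI[OF _ clo[OF rm[OF 2(1)]]], intro ballI conjI impI)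
        (rule bb[OF _ 2(1) _ 2(2)] ab[OF _ 2(1) _ 2(2)]; assumption)+
  next
    case 3
    \<comment> \<open>No monomial occurs, so the condition on \<open>z\<close> is vacuous and zero
      is a default choice.\<close>
    then show ?thesis by (intro bexI[of _ "\<zero>\<^bsub>B\<^esub>"]) auto
  qed
qed

theorem theorem7:
  fixes K :: "('k, 'm) ring_scheme"
    and E :: generators
    and R :: "(monomial \<Rightarrow> 'k) set set"
    and k :: nat
    and a b :: "nat \<Rightarrow> (nat \<Rightarrow> nat) \<Rightarrow> 'k"
    and A :: "('k, 'a, 'p) module_scheme" and \<mu> :: "'a \<Rightarrow> 'a \<Rightarrow> 'a"
    and B :: "('k, 'b, 'q) module_scheme" and \<nu> :: "'b \<Rightarrow> 'b \<Rightarrow> 'b"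
  assumes "field K"
    and "invariant_subspace K E R"
    and "has_rank K E R k"
    and "presented_by K E R k a b"
    and "operad_algebra K E k a b A \<mu>"
    and "tilde_operad_algebra K E k a b B \<nu>"
  shows "operad_algebra K E k a b (tensor_module K A B) (tensor_product_map K A B \<mu> \<nu>) \<and>
    (\<forall>x\<in>carrier A. \<forall>x'\<in>carrier A. \<forall>y\<in>carrier B. \<forall>y'\<in>carrier B.
      tensor_product_map K A B \<mu> \<nu> (pure_tensor K A B x y) (pure_tensor K A B x' y') =
        pure_tensor K A B (\<mu> x x') (\<nu> y y'))"
proof -
  have coeffs: "\<forall>p\<in>{1..k}. a p \<in> Sigma3 \<rightarrow> carrier K \<and> b p \<in> Sigma3 \<rightarrow> carrier K"
    using assms(4) by (auto simp: presented_by_def)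
  note alg_iff = operad_algebra_iff[OF coeffs]
  have algA: "module K A" "bilinear_product K A \<mu>" "has_symmetry E A \<mu>"
    and relA: "\<And>p x. p \<in> {1..k} \<Longrightarrow> x \<in> {1, 2, 3} \<rightarrow> carrier A \<Longrightarrow>
      lin_ext K A (eval_mono \<mu> x) (relator K (a p) (b p)) = \<zero>\<^bsub>A\<^esub>"
    using assms(5) unfolding alg_iff by blast+
  have algB: "module K B" "bilinear_product K B \<nu>" "has_symmetry (tilde_generators E) B \<nu>"
    using assms(6) by (auto simp: tilde_operad_algebra_def)
  interpret product_pair K A B \<mu> \<nu>
    by (intro product_pair.intro module_pair.intro product_pair_axioms.intro algA algB)
  interpret T: module K T by (rule module_tensor)
  have clo: "M s t \<in> carrier T" if "s \<in> carrier T" "t \<in> carrier T" for s t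
    using bilinear_productD(3)[OF bilinear_tensor_product_map that] .
  have \<mu>_closed: "\<mu> x y \<in> carrier A" if "x \<in> carrier A" "y \<in> carrier A" for x y
    using bilinear_productD(3)[OF bil_A that] .
  \<comment> \<open>The regular case imposes nothing. The other two take \<open>\<epsilon>\<close>
    to be 1 or -1, and in both of them \<open>tilde_generators\<close> makes \<open>\<nu>\<close>
    commutative.\<close>
  have "has_symmetry E T M"
  proof (cases E)
    case Regular
    then show ?thesis by simp
  next
    case Trivial
    have A_sym: "\<mu> x y = \<one>\<^bsub>K\<^esub> \<odot>\<^bsub>A\<^esub> \<mu> y x" if "x \<in> carrier A" "y \<in> carrier A" for x y
      unfolding A.smult_one[OF \<mu>_closed[OF that(2,1)]]
      using algA(3) that unfolding Trivial has_symmetry.simps by blast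
    have B_sym: "\<nu> x y = \<nu> y x" if "x \<in> carrier B" "y \<in> carrier B" for x y
      using algB(3) that unfolding Trivial tilde_generators.simps has_symmetry.simps by blast
    have "M s t = M t s" if "s \<in> carrier T" "t \<in> carrier T" for s t
      using tensor_product_map_symmetry[OF A.R.one_closed A_sym B_sym that]
      unfolding T.smult_one[OF clo[OF that(2,1)]] .
    then show ?thesis unfolding Trivial has_symmetry.simps by blast
  next
    case Signum
    have A_sym: "\<mu> x y = (\<ominus>\<^bsub>K\<^esub> \<one>\<^bsub>K\<^esub>) \<odot>\<^bsub>A\<^esub> \<mu> y x" if "x \<in> carrier A" "y \<in> carrier A" for x y
      unfolding A.smult_l_minus[OF A.R.one_closed \<mu>_closed[OF that(2,1)]]
        A.smult_one[OF \<mu>_closed[OF that(2,1)]]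
      using algA(3) that unfolding Signum has_symmetry.simps by blast
    have B_sym: "\<nu> x y = \<nu> y x" if "x \<in> carrier B" "y \<in> carrier B" for x y
      using algB(3) that unfolding Signum tilde_generators.simps has_symmetry.simps by blast
    have "M s t = \<ominus>\<^bsub>T\<^esub> M t s" if "s \<in> carrier T" "t \<in> carrier T" for s t
      using tensor_product_map_symmetry[OF A.R.a_inv_closed[OF A.R.one_closed] A_sym B_sym that]
      unfolding T.smult_l_minus[OF A.R.one_closed clo[OF that(2,1)]] T.smult_one[OF clo[OF that(2,1)]] .
    then show ?thesis unfolding Signum has_symmetry.simps by blast
  qed
  moreover have "lin_ext K T (eval_mono M x) (relator K (a p) (b p)) = \<zero>\<^bsub>T\<^esub>"
    if p: "p \<in> {1..k}" and x: "x \<in> {1, 2, 3} \<rightarrow> carrier T" for p x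
  proof -
    have ab: "a p \<in> Sigma3 \<rightarrow> carrier K" "b p \<in> Sigma3 \<rightarrow> carrier K" using coeffs p by blast+
    show ?thesis
      by (rule relator_tensor_product_map[OF ab relA[OF p] tilde_common_value[OF assms(1,6) p ab] x])
  qed
  ultimately have "operad_algebra K E k a b T M"
    using alg_iff module_tensor bilinear_tensor_product_map by blast
  \<comment> \<open>Since pure tensors span, this formula and bilinearity determine the product,
    which identifies it as the tensor product of the two given ones.\<close>
  then show ?thesis using tensor_product_map_pure by blast
qed

end
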